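(* Let $m$ be a constant. The functions sending $$(1^n\,0\,0\,1^{\alpha_1}\,0\,1^{\alpha_2}\,0\,\cdots\,0\,1^{\alpha_n}\,0\,0\,1^{\beta_1}\,0\,\cdots\,0\,1^{\beta_m})$$ to $\#CT(\alpha,\beta)$ and to $\#CT_0(\alpha,\beta)$, respectively, are in $\#\mathsf{L}$. (Here $n$ is not fixed.)
   Context: Let $\alpha=(\alpha_1,\dots,\alpha_n)$ and $\beta=(\beta_1,\dots,\beta_m)$ be compositions (finite sequences of positive integers) of the same integer. $CT(\alpha,\beta)$ is the set of contingency tables with marginals $\alpha,\beta$: $n\times m$ matrices $A$ with entries in $\mathbb{N}_0$ such that $\sum_i A_{ij}=\beta_j$ for $j=1,\dots,m$ and $\sum_j A_{ij}=\alpha_i$ for $i=1,\dots,n$. $CT_0(\alpha,\beta)$ is the subset of those with all entries in $\{0,1\}$. The alphabet is $\Sigma=\{0,1\}$; $1^a$ is the string of $a$ ones and juxtaposition is concatenation. A function given only on strings of a specified form is extended by $0$ to all other strings. $\#\mathsf{L}$ is the class of functions $f:\Sigma^*\to\mathbb{N}_0$ such that $f(x)$ is the number of accepting computation paths on input $x$ of a fixed nondeterministic Turing machine with read-only input tape that uses $O(\log|x|)$ work space and halts on every computation path. Equivalently: there are a polynomial $q$ and a deterministic $O(\log|x|)$-space Turing machine $M$ with an additional read-once, left-to-right witness tape such that $f(x)=\#\{w\in\Sigma^{q(|x|)}\mid M(x,w)=\mathsf{yes}\}$. *)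

theory Defs
  imports "Jordan_Normal_Form.Matrix" "HOL-Library.Landau_Symbols"
begin

section \<open>Nondeterministic Turing machines with a read-only input tape\<close>

text \<open>
  The alphabet \<open>{0,1}\<close> is \<^typ>\<open>bool\<close>, with \<^term>\<open>True\<close> for the letter 1. The input \<open>x\<close> occupies
  the positions \<open>1, \<dots>, |x|\<close> of the input tape, between two end markers at the positions \<open>0\<close> and
  \<open>|x| + 1\<close>. A machine has some fixed number of two-way infinite work tapes; a work tape is given
  by its contents and its head position. States and work symbols are natural numbers, and the
  work symbol 0 is the blank. A head movement is one of the integers \<open>-1\<close>, \<open>0\<close>, \<open>1\<close>.
\<close>

datatype input_symbol = Left_End | Letter bool | Right_End

text \<open>
  \<open>((q, a, rs), (q', d, as))\<close>: in state \<open>q\<close>, scanning \<open>a\<close> on the input tape and the symbols \<open>rs\<close> on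
  the work tapes, the machine may enter state \<open>q'\<close>, move the input head by \<open>d\<close>, and on the \<open>j\<close>-th
  work tape write the first component of \<open>as ! j\<close> and then move by its second component.
\<close>

type_synonym instruction =
  "(nat \<times> input_symbol \<times> nat list) \<times> (nat \<times> int \<times> (nat \<times> int) list)"

record ntm =
  states :: "nat set"
  symbols :: "nat set"
  num_tapes :: nat
  start :: nat
  accepting :: "nat set"
  instructions :: "instruction set"

definition ntm :: "ntm \<Rightarrow> bool" where
  "ntm M \<longleftrightarrow>
     finite (states M) \<and> finite (symbols M) \<and> 0 \<in> symbols M \<and>
     start M \<in> states M \<and> accepting M \<subseteq> states M \<and>
     (\<forall>((q, a, rs), (q', d, as)) \<in> instructions M.
        q \<in> states M \<and> q' \<in> states M \<and>
        length rs = num_tapes M \<and> set rs \<subseteq> symbols M \<and>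
        d \<in> {-1, 0, 1} \<and> (a = Left_End \<longrightarrow> d \<noteq> -1) \<and> (a = Right_End \<longrightarrow> d \<noteq> 1) \<and>
        length as = num_tapes M \<and> set as \<subseteq> symbols M \<times> {-1, 0, 1})"

type_synonym work_tape = "(int \<Rightarrow> nat) \<times> int"

record config =
  state :: nat
  input_pos :: int
  work :: "work_tape list"

definition scan_input :: "bool list \<Rightarrow> int \<Rightarrow> input_symbol" where
  "scan_input x p =
     (if p \<le> 0 then Left_End
      else if p \<le> int (length x) then Letter (x ! nat (p - 1))
      else Right_End)"

definition scan_work :: "work_tape \<Rightarrow> nat" where
  "scan_work = (\<lambda>(t, h). t h)"

definition act_work :: "work_tape \<Rightarrow> nat \<times> int \<Rightarrow> work_tape" where
  "act_work = (\<lambda>(t, h) (s, d). (t(h := s), h + d))"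

definition init_config :: "ntm \<Rightarrow> config" where
  "init_config M =
     \<lparr>state = start M, input_pos = 0, work = replicate (num_tapes M) (\<lambda>_. 0, 0)\<rparr>"

definition step :: "ntm \<Rightarrow> bool list \<Rightarrow> config \<Rightarrow> config \<Rightarrow> bool" where
  "step M x c c' \<longleftrightarrow>
     (\<exists>q' d as.
        ((state c, scan_input x (input_pos c), map scan_work (work c)), (q', d, as))
          \<in> instructions M \<and>
        c' = \<lparr>state = q', input_pos = input_pos c + d, work = map2 act_work (work c) as\<rparr>)"

definition path_from :: "ntm \<Rightarrow> bool list \<Rightarrow> config \<Rightarrow> config list \<Rightarrow> bool" where
  "path_from M x c cs \<longleftrightarrow> cs \<noteq> [] \<and> hd cs = c \<and> successively (step M x) cs"

text \<open>
  Different instructions applicable to the same configuration lead to different successor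
  configurations (no head ever bounces off an end of a tape), so a computation path is determined by
  its sequence of configurations.
\<close>

abbreviation comp_path :: "ntm \<Rightarrow> bool list \<Rightarrow> config list \<Rightarrow> bool" where
  "comp_path M x \<equiv> path_from M x (init_config M)"

definition halted :: "ntm \<Rightarrow> bool list \<Rightarrow> config \<Rightarrow> bool" where
  "halted M x c \<longleftrightarrow> (\<nexists>c'. step M x c c')"

definition accepting_paths :: "ntm \<Rightarrow> bool list \<Rightarrow> config list set" where
  "accepting_paths M x =
     {cs. comp_path M x cs \<and> halted M x (last cs) \<and> state (last cs) \<in> accepting M}"

definition halts_on_all_paths :: "ntm \<Rightarrow> bool list \<Rightarrow> bool" where
  "halts_on_all_paths M x \<longleftrightarrow>
     (\<nexists>c :: nat \<Rightarrow> config. c 0 = init_config M \<and> (\<forall>i. step M x (c i) (c (Suc i))))"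

text \<open>The number of work tape cells visited along a computation path.\<close>

definition space :: "ntm \<Rightarrow> config list \<Rightarrow> nat" where
  "space M cs = (\<Sum>j<num_tapes M. card ((\<lambda>c. snd (work c ! j)) ` set cs))"

definition sharpL :: "(bool list \<Rightarrow> nat) set" where
  "sharpL =
     {f. \<exists>M s. ntm M \<and> (\<lambda>n. real (s n)) \<in> O(\<lambda>n. ln (real n)) \<and>
          (\<forall>x. halts_on_all_paths M x \<and>
               (\<forall>cs. comp_path M x cs \<longrightarrow> space M cs \<le> s (length x)) \<and>
               f x = card (accepting_paths M x))}"

text \<open>
  The cardinality in \<^const>\<open>sharpL\<close> is always that of a finite set, so the convention that infinite
  sets have cardinality 0 plays no role.
\<close>

lemma finite_instructions:
  assumes "ntm M"
  shows "finite (instructions M)"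
proof -
  let ?R = "{rs. set rs \<subseteq> symbols M \<and> length rs = num_tapes M}"
  let ?A = "{as. set as \<subseteq> symbols M \<times> ({-1, 0, 1} :: int set) \<and> length as = num_tapes M}"
  let ?I = "{Left_End, Letter True, Letter False, Right_End}"
  have I: "a \<in> ?I" for a
  proof (cases a)
    case (Letter b)
    then show ?thesis by (cases b) simp_all
  qed simp_all
  have "instructions M \<subseteq>
      (states M \<times> ?I \<times> ?R) \<times> (states M \<times> {-1, 0, 1} \<times> ?A)"
  proof
    fix t assume t: "t \<in> instructions M"
    obtain q a rs q' d as where "t = ((q, a, rs), (q', d, as))"
      by (metis prod_cases3 surj_pair)
    with t I[of a] assms show "t \<in> (states M \<times> ?I \<times> ?R) \<times> (states M \<times> {-1, 0, 1} \<times> ?A)"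
      unfolding ntm_def by fastforce
  qed
  moreover have "finite ?R" "finite ?A"
    using assms by (auto simp: ntm_def intro!: finite_lists_length_eq)
  ultimately show ?thesis
    using assms by (auto simp: ntm_def intro: finite_subset)
qed

lemma finite_accepting_paths:
  assumes M: "ntm M" and halts: "halts_on_all_paths M x"
  shows "finite (accepting_paths M x)"
proof -
  let ?r = "\<lambda>c' c. step M x c c'"
  have succ: "finite {c'. step M x c c'}" for c
  proof -
    let ?g = "\<lambda>(_, (q', d, as)).
      \<lparr>state = q', input_pos = input_pos c + d, work = map2 act_work (work c) as\<rparr>"
    have "{c'. step M x c c'} \<subseteq> ?g ` instructions M"
    proof
      fix c' assume "c' \<in> {c'. step M x c c'}"
      then obtain l q' d as where "(l, (q', d, as)) \<in> instructions M"
        "c' = ?g (l, (q', d, as))"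
        unfolding step_def by auto
      then show "c' \<in> ?g ` instructions M" by (rule rev_image_eqI)
    qed
    then show ?thesis
      using finite_instructions[OF M] finite_surj by blast
  qed
  have fin: "finite {cs. path_from M x c cs}" if "Wellfounded.accp ?r c" for c
    using that
  proof (rule accp_induct)
    fix c assume IH: "\<forall>c'. ?r c' c \<longrightarrow> finite {cs. path_from M x c' cs}"
    have "{cs. path_from M x c cs} \<subseteq>
        insert [c] (\<Union>c' \<in> {c'. step M x c c'}. (#) c ` {cs. path_from M x c' cs})"
    proof
      fix cs assume "cs \<in> {cs. path_from M x c cs}"
      then show "cs \<in> insert [c] (\<Union>c' \<in> {c'. step M x c c'}. (#) c ` {cs. path_from M x c' cs})"
        by (cases cs) (auto simp: path_from_def successively_Cons image_iff)
    qed
    moreover have "finite \<dots>"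
      using succ IH by auto
    ultimately show "finite {cs. path_from M x c cs}"
      by (rule finite_subset)
  qed
  have "Wellfounded.accp ?r (init_config M)"
  proof (rule ccontr)
    assume "\<not> Wellfounded.accp ?r (init_config M)"
    moreover have "\<exists>c'. \<not> Wellfounded.accp ?r c' \<and> step M x c c'" if "\<not> Wellfounded.accp ?r c" for c
      using that by (meson accp.intros)
    ultimately have "\<exists>c. \<forall>n. (\<not> Wellfounded.accp ?r (c n) \<and> (n = 0 \<longrightarrow> c n = init_config M)) \<and>
        step M x (c n) (c (Suc n))"
      by (intro dependent_nat_choice) auto
    with halts show False
      unfolding halts_on_all_paths_def by blast
  qed
  from fin[OF this] show ?thesis
    unfolding accepting_paths_def by (rule rev_finite_subset) auto
qed


section \<open>Contingency tables\<close>

definition composition :: "nat list \<Rightarrow> bool" where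
  "composition \<alpha> \<longleftrightarrow> (\<forall>a \<in> set \<alpha>. 0 < a)"

definition CT :: "nat list \<Rightarrow> nat list \<Rightarrow> nat mat set" where
  "CT \<alpha> \<beta> =
     {A \<in> carrier_mat (length \<alpha>) (length \<beta>).
        (\<forall>j < length \<beta>. (\<Sum>i < length \<alpha>. A $$ (i, j)) = \<beta> ! j) \<and>
        (\<forall>i < length \<alpha>. (\<Sum>j < length \<beta>. A $$ (i, j)) = \<alpha> ! i)}"

definition CT0 :: "nat list \<Rightarrow> nat list \<Rightarrow> nat mat set" where
  "CT0 \<alpha> \<beta> = {A \<in> CT \<alpha> \<beta>. elements_mat A \<subseteq> {0, 1}}"

lemma finite_CT: "finite (CT \<alpha> \<beta>)"
proof -
  let ?n = "length \<alpha>" and ?m = "length \<beta>"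
  let ?I = "{..<?n} \<times> {..<?m}"
  let ?h = "\<lambda>f. mat ?n ?m f"
  let ?F = "{f. \<forall>p. (p \<in> ?I \<longrightarrow> f p \<in> {..sum_list \<alpha>}) \<and> (p \<notin> ?I \<longrightarrow> f p = 0)}"
  have "CT \<alpha> \<beta> \<subseteq> ?h ` ?F"
  proof
    fix A assume A: "A \<in> CT \<alpha> \<beta>"
    let ?f = "\<lambda>p. if p \<in> ?I then A $$ p else 0"
    have entry: "A $$ (i, j) \<le> sum_list \<alpha>" if "i < ?n" "j < ?m" for i j
    proof -
      have "A $$ (i, j) \<le> (\<Sum>j < ?m. A $$ (i, j))"
        using that by (intro member_le_sum) auto
      also have "\<dots> = \<alpha> ! i"
        using A that by (simp add: CT_def)
      also have "\<dots> \<le> sum_list \<alpha>"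
        using that by (simp add: member_le_sum_list)
      finally show ?thesis .
    qed
    have "?f \<in> ?F" using entry by auto
    moreover have "A = ?h ?f"
      using A by (intro eq_matI) (auto simp: CT_def)
    ultimately show "A \<in> ?h ` ?F" by blast
  qed
  moreover have "finite ?F"
    by (intro finite_set_of_finite_funs) auto
  ultimately show ?thesis
    using finite_surj by blast
qed


section \<open>Encoding the marginals\<close>

fun unary_list :: "nat list \<Rightarrow> bool list" where
  "unary_list [] = []"
| "unary_list [a] = replicate a True"
| "unary_list (a # b # as) = replicate a True @ [False] @ unary_list (b # as)"

definition encode_marginals :: "nat list \<times> nat list \<Rightarrow> bool list" where
  "encode_marginals = (\<lambda>(\<alpha>, \<beta>).
     replicate (length \<alpha>) True @ [False, False] @ unary_list \<alpha> @ [False, False] @ unary_list \<beta>)"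

definition marginals :: "nat \<Rightarrow> (nat list \<times> nat list) set" where
  "marginals m =
     {(\<alpha>, \<beta>). composition \<alpha> \<and> composition \<beta> \<and> sum_list \<alpha> = sum_list \<beta> \<and> length \<beta> = m}"

lemma ones_zero_eq_iff:
  "replicate a True @ False # r = replicate b True @ False # r' \<longleftrightarrow> a = b \<and> r = r'"
proof (induction a arbitrary: b)
  case 0
  then show ?case by (cases b) auto
next
  case (Suc a)
  then show ?case by (cases b) auto
qed

lemma unary_list_append_inj:
  "length as = length bs \<Longrightarrow>
   unary_list as @ False # r = unary_list bs @ False # r' \<Longrightarrow> as = bs \<and> r = r'"
proof (induction as arbitrary: bs rule: unary_list.induct)
  case 1
  then show ?case by simp
next
  case (2 a)
  then obtain b where "bs = [b]" by (cases bs) auto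
  with 2 show ?case by (simp add: ones_zero_eq_iff)
next
  case (3 a b as)
  then obtain a' b' as' where "bs = a' # b' # as'"
    by (metis length_Suc_conv)
  with "3.IH"[of "b' # as'"] "3.prems" show ?case by (simp add: ones_zero_eq_iff)
qed

lemma inj_on_encode_marginals: "inj_on encode_marginals (marginals m)"
proof (rule inj_onI, clarify)
  fix \<alpha> \<beta> \<alpha>' \<beta>'
  assume M: "(\<alpha>, \<beta>) \<in> marginals m" "(\<alpha>', \<beta>') \<in> marginals m"
    and eq: "encode_marginals (\<alpha>, \<beta>) = encode_marginals (\<alpha>', \<beta>')"
  have len: "length \<alpha> = length \<alpha>'"
    and "unary_list \<alpha> @ False # False # unary_list \<beta> = unary_list \<alpha>' @ False # False # unary_list \<beta>'"
    using eq by (auto simp: encode_marginals_def ones_zero_eq_iff)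
  then have "\<alpha> = \<alpha>'" and b: "unary_list \<beta> = unary_list \<beta>'"
    using unary_list_append_inj by blast+
  moreover have "length \<beta> = length \<beta>'"
    using M by (simp add: marginals_def)
  then have "\<beta> = \<beta>'"
    using unary_list_append_inj[of \<beta> \<beta>' "[]" "[]"] b by simp
  ultimately show "\<alpha> = \<alpha>' \<and> \<beta> = \<beta>'" by simp
qed

text \<open>
  A function \<open>g\<close> on \<open>D\<close>, regarded via an injective encoding \<open>e\<close> as a function given only on the
  strings in \<open>e ` D\<close>, and extended by 0 to all other strings.
\<close>

definition zero_ext :: "('a \<Rightarrow> bool list) \<Rightarrow> 'a set \<Rightarrow> ('a \<Rightarrow> nat) \<Rightarrow> bool list \<Rightarrow> nat" where
  "zero_ext e D g x = (if x \<in> e ` D then g (inv_into D e x) else 0)"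

lemma zero_ext_encode_marginals:
  assumes "d \<in> marginals m"
  shows "zero_ext encode_marginals (marginals m) g (encode_marginals d) = g d"
  using assms inj_on_encode_marginals[of m] by (simp add: zero_ext_def)

end

theory Submission
  imports Defs "HOL-Library.Countable" "HOL-Real_Asymp.Real_Asymp"
begin

text \<open>
  Both functions count the accepting runs of a nondeterministic automaton that reads its input once
  from left to right and has \<open>m + 1\<close> counters. At each letter 1 in the block of \<open>\<alpha>\<^sub>i\<close>, it chooses a
  column \<open>j\<close> and increments the counter of that column, which amounts to adding 1 to the entry at
  \<open>(i, j)\<close>. Within a block the chosen columns have to be nondecreasing, or strictly increasing
  for tables with entries in \<open>{0, 1}\<close>. Hence each row of a table arises from exactly one sequence of
  choices (\<open>runs_Row\<close>). While reading \<open>\<beta>\<close>, the automaton decrements the counters of the columns, and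
  it accepts if all counters are 0 at the end. The remaining counter compares \<open>n\<close> with the number of
  blocks, and the states check the format of the input. So the accepting runs on an encoding of
  \<open>(\<alpha>, \<beta>)\<close> correspond to the contingency tables (\<open>runs_encode\<close>), and other inputs have none
  (\<open>word_if_runs\<close>). Only for \<open>m = 0\<close>, where \<open>0000\<close> is the only encoding, is another automaton needed.

  The numbers of accepting runs of a counter automaton form a function in \<^const>\<open>sharpL\<close>
  (\<open>runs_in_sharpL\<close>). A counter is at most the length of the input, so a binary numeral for it fits on
  a work tape of logarithmic length. A Turing machine with one work tape per counter propagates
  carries and borrows deterministically, and its only nondeterminism is the choice of the step of the
  automaton; therefore accepting computations and accepting runs correspond to each other. The final
  test for zero is one sweep over each tape.
\<close>

section \<open>Computation trees\<close>

text \<open>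
  \<open>comp_tree M x B c k\<close>: the tree of all computations of \<open>M\<close> on \<open>x\<close> from \<open>c\<close> is well-founded, in
  all its configurations the work heads are between \<open>-1\<close> and \<open>B\<close>, and exactly \<open>k\<close> of its leaves
  are accepting. This single inductive predicate carries the three requirements on a machine for
  \<^const>\<open>sharpL\<close>, so that a machine can be analysed by going backwards along its computations.
\<close>

inductive comp_tree :: "ntm \<Rightarrow> bool list \<Rightarrow> nat \<Rightarrow> config \<Rightarrow> nat \<Rightarrow> bool"
  for M x B where
  node: "(\<And>j. j < num_tapes M \<Longrightarrow> snd (work c ! j) \<in> {-1..int B}) \<Longrightarrow>
    (\<And>c'. step M x c c' \<Longrightarrow> comp_tree M x B c' (g c')) \<Longrightarrow>
    comp_tree M x B c (if halted M x c then of_bool (state c \<in> accepting M)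
                       else (\<Sum>c' | step M x c c'. g c'))"

lemma comp_tree_halted:
  assumes "\<And>j. j < num_tapes M \<Longrightarrow> snd (work c ! j) \<in> {-1..int B}"
    and "\<And>c'. \<not> step M x c c'"
    and "k = of_bool (state c \<in> accepting M)"
  shows "comp_tree M x B c k"
proof -
  have "halted M x c" using assms(2) by (simp add: halted_def)
  with node[where g = "\<lambda>_. 0", of M c B x] assms show ?thesis by simp
qed

text \<open>
  At a nondeterministic choice, distinct choices \<open>i\<close> have to lead to distinct configurations
  \<open>h i\<close>; only then do the numbers of accepting paths add up.
\<close>

lemma comp_tree_branch:
  assumes "\<And>j. j < num_tapes M \<Longrightarrow> snd (work c ! j) \<in> {-1..int B}"
    and succ: "\<And>c'. step M x c c' \<longleftrightarrow> c' \<in> h ` I" and inj: "inj_on h I"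
    and sub: "\<And>i. i \<in> I \<Longrightarrow> comp_tree M x B (h i) (f i)"
    and na: "state c \<notin> accepting M"
    and k: "k = (\<Sum>i\<in>I. f i)"
  shows "comp_tree M x B c k"
proof -
  let ?g = "\<lambda>c'. f (the_inv_into I h c')"
  have *: "?g (h i) = f i" if "i \<in> I" for i
    using inj that by (simp add: the_inv_into_f_f)
  have "(\<Sum>c' | step M x c c'. ?g c') = sum ?g (h ` I)"
    by (simp add: succ)
  also have "\<dots> = k"
    using inj * by (simp add: sum.reindex k)
  finally have sum: "(\<Sum>c' | step M x c c'. ?g c') = k" .
  have "k = 0" if "halted M x c"
    using that succ k by (auto simp: halted_def)
  with sum na have "(if halted M x c then of_bool (state c \<in> accepting M)
      else (\<Sum>c' | step M x c c'. ?g c')) = k" by simp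
  moreover have "comp_tree M x B c (if halted M x c then of_bool (state c \<in> accepting M)
      else (\<Sum>c' | step M x c c'. ?g c'))"
    by (rule node) (use assms(1) succ sub * in auto)
  ultimately show ?thesis by simp
qed

lemma comp_tree_step:
  assumes "\<And>j. j < num_tapes M \<Longrightarrow> snd (work c ! j) \<in> {-1..int B}"
    and succ: "\<And>d. step M x c d \<longleftrightarrow> d = c'" and sub: "comp_tree M x B c' k"
  shows "comp_tree M x B c k"
proof -
  have "{d. step M x c d} = {c'}" "\<not> halted M x c"
    using succ by (auto simp: halted_def)
  moreover have "comp_tree M x B c (if halted M x c then of_bool (state c \<in> accepting M)
      else (\<Sum>d | step M x c d. k))"
    by (rule node) (use assms in auto)
  ultimately show ?thesis by simp
qed

lemma comp_tree_no_infinite_path: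
  assumes "comp_tree M x B c k"
  shows "\<nexists>f :: nat \<Rightarrow> config. f 0 = c \<and> (\<forall>i. step M x (f i) (f (Suc i)))"
  using assms
proof induction
  case (node c g)
  show ?case
  proof
    assume "\<exists>f :: nat \<Rightarrow> config. f 0 = c \<and> (\<forall>i. step M x (f i) (f (Suc i)))"
    then obtain f :: "nat \<Rightarrow> config" where f: "f 0 = c" "\<And>i. step M x (f i) (f (Suc i))"
      by blast
    have "step M x c (f (Suc 0))" using f(2)[of 0] f(1) by simp
    moreover have "\<exists>h :: nat \<Rightarrow> config. h 0 = f (Suc 0) \<and> (\<forall>i. step M x (h i) (h (Suc i)))"
      by (rule exI[of _ "\<lambda>i. f (Suc i)"]) (simp add: f(2))
    ultimately show False using node by blast
  qed
qed

lemma comp_tree_head_bound: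
  assumes "comp_tree M x B c k" "path_from M x c cs" "c' \<in> set cs" "j < num_tapes M"
  shows "snd (work c' ! j) \<in> {-1..int B}"
  using assms
proof (induction arbitrary: cs)
  case (node c g)
  from node.prems(1) obtain cs' where cs: "cs = c # cs'" "cs' = [] \<or> step M x c (hd cs')"
      "successively (step M x) cs'"
    by (cases cs) (auto simp: path_from_def successively_Cons)
  show ?case
  proof (cases "c' = c")
    case True
    with node show ?thesis by blast
  next
    case False
    with node.prems cs have "c' \<in> set cs'" by auto
    with cs have "path_from M x (hd cs') cs'" "step M x c (hd cs')"
      by (auto simp: path_from_def)
    with node \<open>c' \<in> set cs'\<close> show ?thesis by blast
  qed
qed

lemma finite_successors:
  assumes "ntm M"
  shows "finite {c'. step M x c c'}"
proof -
  let ?g = "\<lambda>(_, (q', d, as)).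
    \<lparr>state = q', input_pos = input_pos c + d, work = map2 act_work (work c) as\<rparr>"
  have "{c'. step M x c c'} \<subseteq> ?g ` instructions M"
  proof
    fix c' assume "c' \<in> {c'. step M x c c'}"
    then obtain l q' d as where "(l, (q', d, as)) \<in> instructions M" "c' = ?g (l, (q', d, as))"
      unfolding step_def by auto
    then show "c' \<in> ?g ` instructions M" by (rule rev_image_eqI)
  qed
  then show ?thesis
    using finite_instructions[OF assms] finite_surj by blast
qed

lemma path_from_Cons:
  "path_from M x c (a # cs) \<longleftrightarrow>
    a = c \<and> (cs = [] \<or> (\<exists>c'. step M x c c' \<and> path_from M x c' cs))"
  by (auto simp: path_from_def successively_Cons)

lemma comp_tree_card:
  assumes "comp_tree M x B c k" "ntm M"
  shows "finite {cs. path_from M x c cs \<and> halted M x (last cs) \<and> state (last cs) \<in> accepting M} \<and>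
    card {cs. path_from M x c cs \<and> halted M x (last cs) \<and> state (last cs) \<in> accepting M} = k"
  using assms(1)
proof induction
  case (node c g)
  define A where
    "A c = {cs. path_from M x c cs \<and> halted M x (last cs) \<and> state (last cs) \<in> accepting M}" for c
  note IH = node.IH[folded A_def]
  have "finite (A c) \<and> card (A c) = (if halted M x c then of_bool (state c \<in> accepting M)
      else (\<Sum>c' | step M x c c'. g c'))"
  proof (cases "halted M x c")
    case True
    have "path_from M x c cs \<longleftrightarrow> cs = [c]" for cs
      using True by (cases cs; cases "tl cs") (auto simp: path_from_def halted_def)
    then have "A c = (if state c \<in> accepting M then {[c]} else {})"
      using True by (simp add: A_def cong: conj_cong)
    then show ?thesis using True by simp
  next
    case False
    have "cs \<in> A c \<longleftrightarrow> (\<exists>c' cs'. step M x c c' \<and> cs = c # cs' \<and> cs' \<in> A c')" for cs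
    proof (cases cs)
      case Nil
      then show ?thesis by (simp add: A_def path_from_def)
    next
      case (Cons a cs')
      have "cs' \<noteq> []" if "path_from M x c' cs'" for c'
        using that by (simp add: path_from_def)
      with Cons False show ?thesis
        by (auto simp: A_def path_from_Cons)
    qed
    then have A: "A c = (\<Union>c' \<in> {c'. step M x c c'}. (#) c ` A c')"
      by blast
    have fin: "\<forall>c' \<in> {c'. step M x c c'}. finite ((#) c ` A c')"
      using IH by auto
    have disj: "\<forall>c' \<in> {c'. step M x c c'}. \<forall>c'' \<in> {c'. step M x c c'}. c' \<noteq> c'' \<longrightarrow>
        (#) c ` A c' \<inter> (#) c ` A c'' = {}"
      by (auto simp: A_def path_from_def)
    have "card (A c) = (\<Sum>c' | step M x c c'. card ((#) c ` A c'))"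
      unfolding A by (rule card_UN_disjoint) (use fin disj finite_successors[OF assms(2)] in auto)
    also have "\<dots> = (\<Sum>c' | step M x c c'. g c')"
      using IH by (intro sum.cong) (auto simp: card_image)
    finally show ?thesis
      using False A fin finite_successors[OF assms(2)] by auto
  qed
  then show ?case by (simp only: A_def)
qed

text \<open>The head positions \<open>-1, \<dots>, B\<close> are \<open>B + 2\<close> cells on each work tape.\<close>

lemma sharpL_if_comp_tree:
  assumes M: "ntm M"
    and tree: "\<And>x. comp_tree M x (b (length x)) (init_config M) (f x)"
    and b: "(\<lambda>n. real (num_tapes M * (b n + 2))) \<in> O(\<lambda>n. ln (real n))"
  shows "f \<in> sharpL"
proof -
  have "space M cs \<le> num_tapes M * (b (length x) + 2)" if "comp_path M x cs" for x cs
  proof -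
    have "card ((\<lambda>c. snd (work c ! j)) ` set cs) \<le> b (length x) + 2" if "j < num_tapes M" for j
    proof -
      have "card ((\<lambda>c. snd (work c ! j)) ` set cs) \<le> card {-1..int (b (length x))}"
        using comp_tree_head_bound[OF tree \<open>comp_path M x cs\<close> _ that]
        by (intro card_mono) auto
      then show ?thesis by simp
    qed
    then have "space M cs \<le> (\<Sum>j<num_tapes M. b (length x) + 2)"
      unfolding space_def by (intro sum_mono) auto
    then show ?thesis by simp
  qed
  moreover have "halts_on_all_paths M x" for x
    using comp_tree_no_infinite_path[OF tree] by (simp add: halts_on_all_paths_def)
  moreover have "f x = card (accepting_paths M x)" for x
    using comp_tree_card[OF tree M] by (simp add: accepting_paths_def)
  ultimately show ?thesis
    unfolding sharpL_def using M b
    by (intro CollectI exI[of _ M] exI[of _ "\<lambda>n. num_tapes M * (b n + 2)"]) auto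
qed


section \<open>Binary counters\<close>

text \<open>
  A numeral is the list of its binary digits, least significant digit first. Leading zeros are
  allowed: \<open>dec\<close> keeps the length, and \<open>inc\<close> extends only a numeral all of whose digits are 1.
\<close>

fun val :: "bool list \<Rightarrow> nat" where
  "val [] = 0"
| "val (b # ds) = of_bool b + 2 * val ds"

fun inc :: "bool list \<Rightarrow> bool list" where
  "inc [] = [True]"
| "inc (False # ds) = True # ds"
| "inc (True # ds) = False # inc ds"

fun dec :: "bool list \<Rightarrow> bool list" where
  "dec [] = []"
| "dec (True # ds) = False # ds"
| "dec (False # ds) = True # dec ds"

lemma val_inc: "val (inc ds) = Suc (val ds)"
  by (induction ds rule: inc.induct) auto

lemma val_dec: "val ds > 0 \<Longrightarrow> val (dec ds) = val ds - 1"
  by (induction ds rule: dec.induct) auto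

lemma length_dec [simp]: "length (dec ds) = length ds"
  by (induction ds rule: dec.induct) auto

lemma length_le_length_inc: "length ds \<le> length (inc ds)"
  by (induction ds rule: inc.induct) auto

lemma length_inc: "length (inc ds) = length ds \<or>
    length (inc ds) = Suc (length ds) \<and> Suc (val ds) = 2 ^ length ds"
  by (induction ds rule: inc.induct) auto

text \<open>
  The contents of a work tape holding a numeral in the cells \<open>0, 1, \<dots>\<close>: the digits 0 and 1 are
  written as the symbols 1 and 2, and all other cells are blank.
\<close>

definition digits :: "bool list \<Rightarrow> int \<Rightarrow> nat" where
  "digits ds = (\<lambda>i. if 0 \<le> i \<and> i < int (length ds) then (if ds ! nat i then 2 else 1) else 0)"

lemma digits_le_2: "digits ds i \<in> {0, 1, 2}"
  by (auto simp: digits_def)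

lemma digits_update:
  "(digits (us @ b # ds))(int (length us) := (if b' then 2 else 1)) = digits (us @ b' # ds)"
  by (rule ext) (auto simp: digits_def nth_append nth_Cons' nat_eq_iff)

lemma digits_append:
  "(digits us)(int (length us) := (if b' then 2 else 1)) = digits (us @ [b'])"
  by (rule ext) (auto simp: digits_def nth_append)

lemma digits_Nil: "digits [] = (\<lambda>_. 0)"
  by (auto simp: digits_def)


section \<open>Counter automata\<close>

text \<open>
  A counter automaton reads its input once from left to right. With each letter it changes its state
  and applies at most one of the operations increment and decrement to one of its \<open>K\<close> counters, which
  hold natural numbers; decrementing 0 is impossible and ends the run. A run is accepting if it reads
  the whole input and ends in a state of \<open>F\<close> with all counters 0.
\<close>

datatype counter_op = Keep | Inc nat | Dec nat

fun counter_of :: "counter_op \<Rightarrow> nat set" where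
  "counter_of Keep = {}"
| "counter_of (Inc j) = {j}"
| "counter_of (Dec j) = {j}"

fun enabled :: "counter_op \<Rightarrow> (nat \<Rightarrow> nat) \<Rightarrow> bool" where
  "enabled (Dec j) c = (c j > 0)"
| "enabled _ c = True"

fun apply_op :: "counter_op \<Rightarrow> (nat \<Rightarrow> nat) \<Rightarrow> nat \<Rightarrow> nat" where
  "apply_op Keep c = c"
| "apply_op (Inc j) c = c(j := Suc (c j))"
| "apply_op (Dec j) c = c(j := c j - 1)"

text \<open>
  The states of a Turing machine that simulates a counter automaton with the states \<open>'q\<close>. In
  \<open>Main q\<close>, all work heads are on cell 0 and the machine is about to simulate a step from \<open>q\<close>; in
  \<open>Up j q\<close> and \<open>Down j q\<close>, it is propagating a carry or a borrow on tape \<open>j\<close>; in \<open>Back j q\<close>, it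
  is returning to cell 0 of tape \<open>j\<close>, in order to continue with \<open>Main q\<close>; in \<open>Test j\<close>, it is
  checking at the end of the input that the counters from \<open>j\<close> on are 0.
\<close>

datatype 'q machine_state = Main 'q | Up nat 'q | Down nat 'q | Back nat 'q | Test nat

instance machine_state :: (countable) countable
  by countable_datatype

text \<open>
  States are countable so that they can be encoded as natural numbers. There has to be a counter
  because every step of the simulating machine acts on some work tape.
\<close>

locale counter_automaton =
  fixes K :: nat and Q :: "'q::countable set" and q0 :: 'q and F :: "'q set"
    and \<delta> :: "'q \<Rightarrow> bool \<Rightarrow> ('q \<times> counter_op) set"
  assumes K: "0 < K" and finite_Q: "finite Q" and q0: "q0 \<in> Q"
    and \<delta>: "q \<in> Q \<Longrightarrow> (q', w) \<in> \<delta> q a \<Longrightarrow> q' \<in> Q \<and> counter_of w \<subseteq> {..<K}"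
begin

text \<open>The number of accepting runs on a word from state \<open>q\<close> with the counter values \<open>c\<close>.\<close>

fun runs :: "'q \<Rightarrow> (nat \<Rightarrow> nat) \<Rightarrow> bool list \<Rightarrow> nat" where
  "runs q c [] = of_bool (q \<in> F \<and> (\<forall>j<K. c j = 0))"
| "runs q c (a # w) =
    (\<Sum>(q', u) \<in> \<delta> q a. if enabled u c then runs q' (apply_op u c) w else 0)"

text \<open>The state in which the machine starts to carry out an operation, in order to continue from \<open>q\<close>.\<close>

fun enter :: "counter_op \<Rightarrow> 'q \<Rightarrow> 'q machine_state" where
  "enter Keep q = Main q"
| "enter (Inc j) q = Up j q"
| "enter (Dec j) q = Down j q"

lemma enter_inject: "enter u q = enter u' q' \<longleftrightarrow> u = u' \<and> q = q'"
  by (cases u; cases u') auto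

definition machine_states :: "'q machine_state set" where
  "machine_states = Main ` Q \<union> (\<Union>j<K. Up j ` Q \<union> Down j ` Q \<union> Back j ` Q) \<union> Test ` {..K}"

text \<open>
  In each state, the machine reads, changes and moves on one work tape only, the active one.
  An element \<open>(s', d, b, e)\<close> of \<open>machine_trans s a r\<close> is a possible action in state \<open>s\<close> on the input
  symbol \<open>a\<close> and the symbol \<open>r\<close> of the active tape: enter \<open>s'\<close>, move the input head by \<open>d\<close>, write
  \<open>b\<close> on the active tape and move its head by \<open>e\<close>.
\<close>

fun active :: "'q machine_state \<Rightarrow> nat" where
  "active (Main q) = 0"
| "active (Up j q) = j"
| "active (Down j q) = j"
| "active (Back j q) = j"
| "active (Test j) = (if j < K then j else 0)"

fun machine_trans ::
  "'q machine_state \<Rightarrow> input_symbol \<Rightarrow> nat \<Rightarrow> ('q machine_state \<times> int \<times> nat \<times> int) set" where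
  "machine_trans (Main q) Left_End r = {(Main q, 1, r, 0)}"
| "machine_trans (Main q) (Letter a) r = (\<lambda>(q', u). (enter u q', 1, r, 0)) ` \<delta> q a"
| "machine_trans (Main q) Right_End r = (if q \<in> F then {(Test 0, 0, r, 0)} else {})"
| "machine_trans (Up j q) a r = (if r = 2 then {(Up j q, 0, 1, 1)} else {(Back j q, 0, 2, -1)})"
| "machine_trans (Down j q) a r = (if r = 0 then {} else if r = 1 then {(Down j q, 0, 2, 1)}
                          else {(Back j q, 0, 1, -1)})"
| "machine_trans (Back j q) a r = (if r = 0 then {(Main q, 0, 0, 1)} else {(Back j q, 0, r, -1)})"
| "machine_trans (Test j) a r = (if j < K then
      if r = 0 then {(Test (Suc j), 0, 0, 0)} else if r = 1 then {(Test j, 0, 1, 1)} else {}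
    else {})"

inductive_set machine_instructions :: "instruction set" where
  "s \<in> machine_states \<Longrightarrow> length rs = K \<Longrightarrow> set rs \<subseteq> {0, 1, 2} \<Longrightarrow>
   (s', d, b, e) \<in> machine_trans s a (rs ! active s) \<Longrightarrow>
   ((to_nat s, a, rs), (to_nat s', d, (map (\<lambda>r. (r, 0)) rs)[active s := (b, e)])) \<in> machine_instructions"

text \<open>The machine accepts by passing the zero tests of all counters and reaching \<open>Test K\<close>.\<close>

definition machine :: ntm where
  "machine = \<lparr>states = to_nat ` machine_states, symbols = {0, 1, 2}, num_tapes = K,
     start = to_nat (Main q0), accepting = {to_nat (Test K :: 'q machine_state)},
     instructions = machine_instructions\<rparr>"

lemma active_less: "s \<in> machine_states \<Longrightarrow> active s < K"
  using K by (auto simp: machine_states_def)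

lemma enter_in: "q \<in> Q \<Longrightarrow> (q', u) \<in> \<delta> q a \<Longrightarrow> enter u q' \<in> machine_states"
  using \<delta>[of q q' u a] by (cases u) (auto simp: machine_states_def)

lemma machine_trans_wf:
  assumes "s \<in> machine_states" "(s', d, b, e) \<in> machine_trans s a r" "r \<in> {0, 1, 2}"
  shows "s' \<in> machine_states \<and> d \<in> {-1, 0, 1} \<and> (a = Left_End \<longrightarrow> d \<noteq> -1) \<and>
    (a = Right_End \<longrightarrow> d \<noteq> 1) \<and> b \<in> {0, 1, 2} \<and> e \<in> {-1, 0, 1}"
proof (cases s)
  case (Main q)
  with assms have "q \<in> Q" by (auto simp: machine_states_def)
  then have "Main q \<in> machine_states" "Test 0 \<in> machine_states"
    by (auto simp: machine_states_def)
  with Main assms \<open>q \<in> Q\<close> show ?thesis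
    by (cases a) (auto simp: enter_in split: if_splits)
qed (use assms in \<open>auto simp: machine_states_def split: if_splits\<close>)

lemma ntm_machine: "ntm machine"
proof -
  have ins: "q \<in> states machine \<and> q' \<in> states machine \<and>
      length rs = num_tapes machine \<and> set rs \<subseteq> symbols machine \<and>
      d \<in> {-1, 0, 1} \<and> (a = Left_End \<longrightarrow> d \<noteq> -1) \<and> (a = Right_End \<longrightarrow> d \<noteq> 1) \<and>
      length as = num_tapes machine \<and> set as \<subseteq> symbols machine \<times> {-1, 0, 1}"
    if ins: "((q, a, rs), (q', d, as)) \<in> instructions machine" for q a rs q' d as
  proof -
    obtain s s' b e where s: "q = to_nat s" "q' = to_nat s'" "s \<in> machine_states" "length rs = K"
        "set rs \<subseteq> {0, 1, 2}" "(s', d, b, e) \<in> machine_trans s a (rs ! active s)"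
      and as: "as = (map (\<lambda>r. (r, 0)) rs)[active s := (b, e)]"
      using ins unfolding machine_def ntm.select_convs by (cases rule: machine_instructions.cases)
    have "rs ! active s \<in> set rs"
      using s active_less by simp
    then have "rs ! active s \<in> {0, 1, 2}" by (rule subsetD[OF s(5)])
    note wf = machine_trans_wf[OF s(3,6) this]
    have "set as \<subseteq> insert (b, e) ((\<lambda>r. (r, 0)) ` set rs)"
      unfolding as using set_update_subset_insert[of "map (\<lambda>r. (r, 0)) rs" "active s" "(b, e)"] by simp
    also have "\<dots> \<subseteq> {0, 1, 2} \<times> {-1, 0, 1}"
    proof (rule insert_subsetI)
      show "(b, e) \<in> {0, 1, 2} \<times> {-1, 0, 1}"
        using wf by (simp only: mem_Sigma_iff simp_thms)
      show "(\<lambda>r. (r, 0)) ` set rs \<subseteq> {0, 1, 2} \<times> {-1, 0, 1}"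
        by (rule image_subsetI, rule SigmaI, erule subsetD[OF s(5)], simp)
    qed
    finally show ?thesis
      using s wf by (simp add: machine_def as)
  qed
  have "finite machine_states" "Main q0 \<in> machine_states" "Test K \<in> machine_states"
    using finite_Q q0 by (auto simp: machine_states_def)
  then have "finite (states machine)" "finite (symbols machine)" "0 \<in> symbols machine"
      "start machine \<in> states machine" "accepting machine \<subseteq> states machine"
    by (simp_all add: machine_def)
  moreover have "\<forall>((q, a, rs), (q', d, as)) \<in> instructions machine.
      q \<in> states machine \<and> q' \<in> states machine \<and>
      length rs = num_tapes machine \<and> set rs \<subseteq> symbols machine \<and>
      d \<in> {-1, 0, 1} \<and> (a = Left_End \<longrightarrow> d \<noteq> -1) \<and> (a = Right_End \<longrightarrow> d \<noteq> 1) \<and>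
      length as = num_tapes machine \<and> set as \<subseteq> symbols machine \<times> {-1, 0, 1}"
    (is "Ball _ ?P")
  proof
    fix t assume t: "t \<in> instructions machine"
    obtain q a rs q' d as where eq: "t = ((q, a, rs), (q', d, as))"
      by (metis prod_cases3 surj_pair)
    show "?P t" unfolding eq prod.case by (rule ins[OF t[unfolded eq]])
  qed
  ultimately show ?thesis
    unfolding ntm_def by (intro conjI)
qed

text \<open>A configuration in which each work tape holds a numeral, given with the head position.\<close>

definition conf :: "'q machine_state \<Rightarrow> int \<Rightarrow> (bool list \<times> int) list \<Rightarrow> config" where
  "conf s p ts = \<lparr>state = to_nat s, input_pos = p, work = map (\<lambda>(ds, h). (digits ds, h)) ts\<rparr>"

lemma init_config_eq: "init_config machine = conf (Main q0) 0 (replicate K ([], 0))"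
  by (simp add: init_config_def conf_def machine_def digits_Nil)

lemma act_work_update:
  assumes "i < length ws"
  shows "map2 act_work ws ((map (\<lambda>r. (r, 0)) (map scan_work ws))[i := (b, e)]) =
    ws[i := act_work (ws ! i) (b, e)]"
  using assms
  by (intro nth_equalityI)
     (auto simp: nth_list_update act_work_def scan_work_def split: prod.splits)

lemma step_conf:
  assumes "s \<in> machine_states" "length ts = K" and t: "ts ! active s = (ds, h)"
  shows "step machine x (conf s p ts) c' \<longleftrightarrow>
    (\<exists>s' d b e. (s', d, b, e) \<in> machine_trans s (scan_input x p) (digits ds h) \<and>
      c' = \<lparr>state = to_nat s', input_pos = p + d,
        work = (map (\<lambda>(ds, h). (digits ds, h)) ts)[active s := ((digits ds)(h := b), h + e)]\<rparr>)"
proof -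
  let ?ws = "map (\<lambda>(ds, h). (digits ds, h)) ts"
  let ?rs = "map scan_work ?ws"
  have a: "active s < length ts" using assms active_less by simp
  have "scan_work ((\<lambda>(ds, h). (digits ds, h)) t) \<in> {0, 1, 2}" for t
    using digits_le_2[of "fst t" "snd t"] by (simp add: scan_work_def split_beta)
  then have set: "set ?rs \<subseteq> {0, 1, 2}"
    by (simp only: set_map image_image) (rule image_subsetI)
  have rs: "length ?rs = K" "?rs ! active s = digits ds h"
    using assms a by (simp_all add: scan_work_def)
  have w: "map2 act_work ?ws ((map (\<lambda>r. (r, 0)) ?rs)[active s := (b, e)]) =
      ?ws[active s := ((digits ds)(h := b), h + e)]" for b e
    using act_work_update[of "active s" ?ws b e] a t by (simp add: act_work_def)
  have "((to_nat s, y, ?rs), (q', d, as)) \<in> instructions machine \<longleftrightarrow>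
      (\<exists>s' b e. q' = to_nat s' \<and> as = (map (\<lambda>r. (r, 0)) ?rs)[active s := (b, e)] \<and>
        (s', d, b, e) \<in> machine_trans s y (digits ds h))" for y q' d as
    using assms(1) rs set by (auto simp: machine_def machine_instructions.simps simp del: map_map)
  then show ?thesis
    unfolding step_def by (simp add: conf_def w del: map_map) (metis w)
qed

text \<open>
  The numerals have length at most \<open>B\<close>, and the heads are on them or on one of the blanks next to them.
\<close>

definition fits :: "nat \<Rightarrow> (bool list \<times> int) list \<Rightarrow> bool" where
  "fits B ts \<longleftrightarrow> length ts = K \<and> (\<forall>j<K. length (fst (ts ! j)) \<le> B \<and>
     -1 \<le> snd (ts ! j) \<and> snd (ts ! j) \<le> int (length (fst (ts ! j))))"

lemma fits_update:
  "fits B ts \<Longrightarrow> length ds \<le> B \<Longrightarrow> -1 \<le> h \<Longrightarrow> h \<le> int (length ds) \<Longrightarrow> fits B (ts[j := (ds, h)])"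
  by (cases "j < length ts") (simp_all add: fits_def nth_list_update)

lemma fits_heads:
  assumes "fits B ts" "j < num_tapes machine"
  shows "snd (work (conf s p ts) ! j) \<in> {-1..int B}"
proof -
  from assms have j: "j < length ts" "length (fst (ts ! j)) \<le> B"
      "-1 \<le> snd (ts ! j)" "snd (ts ! j) \<le> int (length (fst (ts ! j)))"
    by (simp_all add: fits_def machine_def)
  have "snd (work (conf s p ts) ! j) = snd (ts ! j)"
    using j(1) by (simp add: conf_def split_beta)
  with j show ?thesis by simp
qed

lemma machine_states_intros:
  "q \<in> Q \<Longrightarrow> Main q \<in> machine_states"
  "j < K \<Longrightarrow> q \<in> Q \<Longrightarrow> Up j q \<in> machine_states"
  "j < K \<Longrightarrow> q \<in> Q \<Longrightarrow> Down j q \<in> machine_states"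
  "j < K \<Longrightarrow> q \<in> Q \<Longrightarrow> Back j q \<in> machine_states"
  "j \<le> K \<Longrightarrow> Test j \<in> machine_states"
  by (auto simp: machine_states_def)

text \<open>
  A deterministic step, used backwards: the computation tree of the successor yields that of the
  configuration, with the same number of accepting leaves.
\<close>

lemma tree_step:
  assumes ts: "fits B ts" and ds: "length ds \<le> B" "-1 \<le> h" "h \<le> int (length ds)"
    and s: "s \<in> machine_states" "active s = j"
    and trans: "machine_trans s (scan_input x p) (digits ds h) = {(s', d, b, e)}"
    and ds': "(digits ds)(h := b) = digits ds'"
    and tree: "comp_tree machine x B (conf s' (p + d) (ts[j := (ds', h + e)])) k"
  shows "comp_tree machine x B (conf s p (ts[j := (ds, h)])) k"
proof (rule comp_tree_step[OF _ _ tree])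
  let ?ts = "ts[j := (ds, h)]"
  have f: "fits B ?ts" using ts ds by (rule fits_update)
  have l: "length ?ts = K" "?ts ! active s = (ds, h)"
    using f ts s active_less[OF s(1)] by (simp_all add: fits_def)
  show "step machine x (conf s p ?ts) c \<longleftrightarrow> c = conf s' (p + d) (ts[j := (ds', h + e)])" for c
    unfolding step_conf[OF s(1) l] trans s(2)
    by (auto simp: conf_def map_update ds'[symmetric])
  show "snd (work (conf s p ?ts) ! i) \<in> {-1..int B}" if "i < num_tapes machine" for i
    using f that by (rule fits_heads)
qed

lemma tree_reject:
  assumes ts: "fits B ts" and ds: "length ds \<le> B" "-1 \<le> h" "h \<le> int (length ds)"
    and s: "s \<in> machine_states" "active s = j" "s \<noteq> Test K"
    and trans: "machine_trans s (scan_input x p) (digits ds h) = {}"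
  shows "comp_tree machine x B (conf s p (ts[j := (ds, h)])) 0"
proof (rule comp_tree_halted)
  let ?ts = "ts[j := (ds, h)]"
  have f: "fits B ?ts" using ts ds by (rule fits_update)
  have l: "length ?ts = K" "?ts ! active s = (ds, h)"
    using f ts s active_less[OF s(1)] by (simp_all add: fits_def)
  show "\<not> step machine x (conf s p ?ts) c" for c
    unfolding step_conf[OF s(1) l] trans by simp
  show "snd (work (conf s p ?ts) ! i) \<in> {-1..int B}" if "i < num_tapes machine" for i
    using f that by (rule fits_heads)
  show "0 = of_bool (state (conf s p ?ts) \<in> accepting machine)"
    using s by (simp add: conf_def machine_def)
qed

lemma tree_Back:
  assumes "fits B ts" "length ds \<le> B" "j < K" "q \<in> Q"
    and tree: "comp_tree machine x B (conf (Main q) p (ts[j := (ds, 0)])) k"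
    and "i \<le> length ds"
  shows "comp_tree machine x B (conf (Back j q) p (ts[j := (ds, int i - 1)])) k"
  using \<open>i \<le> length ds\<close>
proof (induction i)
  case 0
  have "digits ds (-1) = 0" "(digits ds)(-1 := 0) = digits ds"
    by (auto simp: digits_def)
  then show ?case
    using tree_step[OF assms(1,2), of "-1" "Back j q" j x p "Main q" 0 0 1 ds k]
      machine_states_intros(4)[OF assms(3,4)] tree by simp
next
  case (Suc i)
  let ?r = "digits ds (int i)"
  have "?r \<noteq> 0" using Suc.prems by (simp add: digits_def)
  then show ?case
    using tree_step[OF assms(1,2), of "int i" "Back j q" j x p "Back j q" 0 ?r "-1" ds k]
      machine_states_intros(4)[OF assms(3,4)] Suc by simp
qed

text \<open>
  When the carry has reached cell \<open>i\<close>, the digits below are 0 and \<open>ds\<close> is the part of the numeral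
  that is still to be incremented.
\<close>

lemma tree_Up:
  assumes "fits B ts" "j < K" "q \<in> Q" "i + length (inc ds) \<le> B"
    and "comp_tree machine x B (conf (Main q) p (ts[j := (replicate i False @ inc ds, 0)])) k"
  shows "comp_tree machine x B (conf (Up j q) p (ts[j := (replicate i False @ ds, int i)])) k"
  using assms(4,5)
proof (induction ds arbitrary: i rule: inc.induct)
  case 1
  let ?ds = "replicate i False @ [True]"
  have "digits (replicate i False) (int i) = 0"
    by (simp add: digits_def)
  moreover have "(digits (replicate i False))(int i := 2) = digits ?ds"
    using digits_append[of "replicate i False" True] by simp
  moreover have "comp_tree machine x B (conf (Back j q) p (ts[j := (?ds, int i - 1)])) k"
    by (rule tree_Back) (use assms 1 in auto)
  ultimately show ?case
    using tree_step[OF assms(1), of "replicate i False" "int i" "Up j q" j x p "Back j q" 0 2 "-1" ?ds k]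
      machine_states_intros(2)[OF assms(2,3)] 1 by simp
next
  case (2 ds)
  let ?ds = "replicate i False @ True # ds"
  have "digits (replicate i False @ False # ds) (int i) = 1"
    by (simp add: digits_def nth_append)
  moreover have "(digits (replicate i False @ False # ds))(int i := 2) = digits ?ds"
    using digits_update[of "replicate i False" False ds True] by simp
  moreover have "comp_tree machine x B (conf (Back j q) p (ts[j := (?ds, int i - 1)])) k"
    by (rule tree_Back) (use assms 2 in auto)
  ultimately show ?case
    using tree_step[OF assms(1), of "replicate i False @ False # ds" "int i" "Up j q" j x p
        "Back j q" 0 2 "-1" ?ds k]
      machine_states_intros(2)[OF assms(2,3)] 2 by simp
next
  case (3 ds)
  let ?ds = "replicate i False @ False # ds"
  have "digits (replicate i False @ True # ds) (int i) = 2"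
    by (simp add: digits_def nth_append)
  moreover have "(digits (replicate i False @ True # ds))(int i := 1) = digits ?ds"
    using digits_update[of "replicate i False" True ds False] by simp
  moreover have r: "replicate (Suc i) False @ ys = replicate i False @ False # ys" for ys
    by (simp add: replicate_app_Cons_same)
  have "comp_tree machine x B (conf (Up j q) p (ts[j := (?ds, int i + 1)])) k"
    using "3.IH"[of "Suc i"] "3.prems" unfolding r by (simp add: add.commute)
  moreover have "i + length ds < B" using "3.prems" length_le_length_inc[of ds] by simp
  ultimately show ?case
    using tree_step[OF assms(1), of "replicate i False @ True # ds" "int i" "Up j q" j x p
        "Up j q" 0 1 1 ?ds k]
      machine_states_intros(2)[OF assms(2,3)] by simp
qed

text \<open>
  Similarly for a borrow. On a counter with value 0 the borrow runs into the blank behind the numeral,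
  where the machine halts without accepting.
\<close>

lemma tree_Down:
  assumes "fits B ts" "j < K" "q \<in> Q" "i + length ds \<le> B"
    and "val ds > 0 \<Longrightarrow>
      comp_tree machine x B (conf (Main q) p (ts[j := (replicate i True @ dec ds, 0)])) k"
  shows "comp_tree machine x B (conf (Down j q) p (ts[j := (replicate i True @ ds, int i)]))
    (if val ds > 0 then k else 0)"
  using assms(4,5)
proof (induction ds arbitrary: i rule: dec.induct)
  case 1
  have "digits (replicate i True) (int i) = 0"
    by (simp add: digits_def)
  then show ?case
    using tree_reject[OF assms(1), of "replicate i True" "int i" "Down j q" j x p]
      machine_states_intros(3)[OF assms(2,3)] 1 by simp
next
  case (2 ds)
  let ?ds = "replicate i True @ False # ds"
  have "digits (replicate i True @ True # ds) (int i) = 2"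
    by (simp add: digits_def nth_append)
  moreover have "(digits (replicate i True @ True # ds))(int i := 1) = digits ?ds"
    using digits_update[of "replicate i True" True ds False] by simp
  moreover have "comp_tree machine x B (conf (Back j q) p (ts[j := (?ds, int i - 1)])) k"
    by (rule tree_Back) (use assms 2 in auto)
  ultimately show ?case
    using tree_step[OF assms(1), of "replicate i True @ True # ds" "int i" "Down j q" j x p
        "Back j q" 0 1 "-1" ?ds k]
      machine_states_intros(3)[OF assms(2,3)] 2 by simp
next
  case (3 ds)
  let ?ds = "replicate i True @ True # ds"
  let ?k = "if val (False # ds) > 0 then k else 0"
  have "digits (replicate i True @ False # ds) (int i) = 1"
    by (simp add: digits_def nth_append)
  moreover have "(digits (replicate i True @ False # ds))(int i := 2) = digits ?ds"
    using digits_update[of "replicate i True" False ds True] by simp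
  moreover have r: "replicate (Suc i) True @ ys = replicate i True @ True # ys" for ys
    by (simp add: replicate_app_Cons_same)
  have "comp_tree machine x B (conf (Down j q) p (ts[j := (?ds, int i + 1)])) ?k"
    using "3.IH"[of "Suc i"] "3.prems" unfolding r by (simp add: add.commute)
  ultimately show ?case
    using tree_step[OF assms(1), of "replicate i True @ False # ds" "int i" "Down j q" j x p
        "Down j q" 0 2 1 ?ds ?k]
      machine_states_intros(3)[OF assms(2,3)] "3.prems" by simp
qed

lemma tree_Test_sweep:
  assumes "fits B ts" "length ds \<le> B" "j < K" "i \<le> length ds"
    and tree: "comp_tree machine x B (conf (Test (Suc j)) p (ts[j := (ds, int (length ds))])) k"
  shows "comp_tree machine x B (conf (Test j) p (ts[j := (ds, int i)]))
    (if val (drop i ds) = 0 then k else 0)"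
  using \<open>i \<le> length ds\<close>
proof (induction i rule: inc_induct)
  case base
  have "digits ds (int (length ds)) = 0" "(digits ds)(int (length ds) := 0) = digits ds"
    by (auto simp: digits_def)
  then show ?case
    using tree_step[OF assms(1,2), of "int (length ds)" "Test j" j x p "Test (Suc j)" 0 0 0 ds k]
      machine_states_intros(5)[of j] tree assms(3) by simp
next
  case (step i)
  let ?k = "if val (drop (Suc i) ds) = 0 then k else 0"
  have drop: "drop i ds = ds ! i # drop (Suc i) ds"
    using step.hyps by (simp add: Cons_nth_drop_Suc)
  show ?case
  proof (cases "ds ! i")
    case True
    then have "digits ds (int i) = 2" using step.hyps by (simp add: digits_def)
    then show ?thesis
      using tree_reject[OF assms(1,2), of "int i" "Test j" j x p]
        machine_states_intros(5)[of j] assms(3) step.hyps drop True by simp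
  next
    case False
    then have "digits ds (int i) = 1" using step.hyps by (simp add: digits_def)
    moreover from this have "(digits ds)(int i := 1) = digits ds" by auto
    moreover have "(if val (drop i ds) = 0 then k else 0) = ?k"
      using False drop by simp
    moreover have "comp_tree machine x B (conf (Test j) p (ts[j := (ds, int i + 1)])) ?k"
      using step.IH by (simp add: add.commute)
    ultimately show ?thesis
      using tree_step[OF assms(1,2), of "int i" "Test j" j x p "Test j" 0 1 1 ds ?k]
        machine_states_intros(5)[of j] assms(3) step.hyps by simp
  qed
qed

lemma tree_Test:
  assumes "fits B ts" "\<And>i. j \<le> i \<Longrightarrow> i < K \<Longrightarrow> snd (ts ! i) = 0" "j \<le> K"
  shows "comp_tree machine x B (conf (Test j) p ts)
    (of_bool (\<forall>i. j \<le> i \<and> i < K \<longrightarrow> val (fst (ts ! i)) = 0))"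
  using \<open>j \<le> K\<close> assms(1,2)
proof (induction j arbitrary: ts rule: inc_induct)
  case base
  obtain ds h where t: "ts ! 0 = (ds, h)" by force
  have l: "length ts = K" using base by (simp add: fits_def)
  have "Test K \<in> machine_states" by (rule machine_states_intros) simp
  then have "\<not> step machine x (conf (Test K) p ts) c" for c
    using step_conf[OF _ l, of "Test K" ds h] t by simp
  then show ?case
    by (intro comp_tree_halted[OF fits_heads[OF base(1)]]) (auto simp: conf_def machine_def)
next
  case (step j)
  have l: "length ts = K" using step.prems by (simp add: fits_def)
  define ds where "ds = fst (ts ! j)"
  have t: "ts ! j = (ds, 0)"
    using step.prems(2)[of j] step.hyps by (simp add: ds_def prod_eq_iff)
  have B: "length ds \<le> B" using step.prems(1) step.hyps by (simp add: fits_def ds_def)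
  let ?ts = "ts[j := (ds, int (length ds))]"
  have id: "ts[j := (ds, 0)] = ts" using t by (metis list_update_id)
  have eq: "(\<forall>i. Suc j \<le> i \<and> i < K \<longrightarrow> val (fst (?ts ! i)) = 0) \<longleftrightarrow>
      (\<forall>i. Suc j \<le> i \<and> i < K \<longrightarrow> val (fst (ts ! i)) = 0)"
    by auto
  have "fits B ?ts" by (rule fits_update[OF step.prems(1) B]) simp_all
  moreover have "snd (?ts ! i) = 0" if "Suc j \<le> i" "i < K" for i
    using step.prems(2)[of i] that by simp
  ultimately have "comp_tree machine x B (conf (Test (Suc j)) p ?ts)
      (of_bool (\<forall>i. Suc j \<le> i \<and> i < K \<longrightarrow> val (fst (?ts ! i)) = 0))"
    by (rule step.IH)
  from tree_Test_sweep[OF step.prems(1) B step.hyps(2) le0 this[unfolded eq]]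
  have "comp_tree machine x B (conf (Test j) p ts)
    (if val ds = 0 then of_bool (\<forall>i. Suc j \<le> i \<and> i < K \<longrightarrow> val (fst (ts ! i)) = 0) else 0)"
    by (simp add: id)
  moreover have "(\<forall>i. j \<le> i \<and> i < K \<longrightarrow> val (fst (ts ! i)) = 0) \<longleftrightarrow>
      val ds = 0 \<and> (\<forall>i. Suc j \<le> i \<and> i < K \<longrightarrow> val (fst (ts ! i)) = 0)"
    using step.hyps t by (metis Suc_leD Suc_leI fst_conv le_neq_implies_less order_refl)
  moreover have "(if a then of_bool b else 0) = (of_bool (a \<and> b) :: nat)" for a b
    by simp
  ultimately show ?case by (simp only:)
qed

text \<open>The work tapes between two simulated steps: all heads are on cell 0.\<close>

definition tapes :: "bool list list \<Rightarrow> (bool list \<times> int) list" where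
  "tapes dss = map (\<lambda>ds. (ds, 0)) dss"

lemma tapes_simps [simp]:
  "length (tapes dss) = length dss"
  "j < length dss \<Longrightarrow> tapes dss ! j = (dss ! j, 0)"
  "tapes (dss[j := ds]) = (tapes dss)[j := (ds, 0)]"
  by (simp_all add: tapes_def map_update)

lemma tapes_update_id: "(tapes dss)[j := (dss ! j, 0)] = tapes dss"
  by (metis list_update_id tapes_simps(3))

lemma fits_tapes:
  assumes "length dss = K" "(N :: nat) < 2 ^ Suc B" "\<And>j. j < K \<Longrightarrow> 2 ^ length (dss ! j) \<le> N"
  shows "fits B (tapes dss)"
proof -
  have "length (dss ! j) \<le> B" if "j < K" for j
  proof -
    have "(2::nat) ^ length (dss ! j) < 2 ^ Suc B"
      using assms(2) assms(3)[OF that] by (rule le_less_trans[rotated])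
    then have "length (dss ! j) < Suc B" by (rule power_less_imp_less_exp[rotated]) simp
    then show ?thesis by simp
  qed
  then show ?thesis using assms(1) by (simp add: fits_def)
qed

text \<open>
  The invariant of the simulation after \<open>l\<close> letters: the tapes hold the counter values, these are at
  most \<open>l\<close>, and the numerals have logarithmic length. The last part is preserved because a numeral of
  length \<open>k\<close> gets longer only when its value becomes \<open>2 ^ k\<close>, whence \<open>2 ^ Suc k \<le> 2 * l\<close>; the
  summand 1 covers the empty numeral.
\<close>

definition represents :: "nat \<Rightarrow> bool list list \<Rightarrow> (nat \<Rightarrow> nat) \<Rightarrow> bool" where
  "represents l dss c \<longleftrightarrow> length dss = K \<and>
     (\<forall>j<K. val (dss ! j) = c j \<and> c j \<le> l \<and> 2 ^ length (dss ! j) \<le> 2 * l + 1)"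

lemma represents_Suc:
  assumes "represents l dss c"
  shows "represents (Suc l) dss c"
proof -
  have "val (dss ! j) = c j \<and> c j \<le> Suc l \<and> 2 ^ length (dss ! j) \<le> 2 * Suc l + 1" if "j < K" for j
  proof -
    have "val (dss ! j) = c j \<and> c j \<le> l \<and> 2 ^ length (dss ! j) \<le> 2 * l + 1"
      using assms that by (simp add: represents_def)
    then show ?thesis by auto
  qed
  then show ?thesis using assms by (simp add: represents_def)
qed

lemma represents_inc:
  assumes "represents l dss c" "j < K"
  shows "represents (Suc l) (dss[j := inc (dss ! j)]) (c(j := Suc (c j)))"
proof -
  have j: "val (dss ! j) = c j" "c j \<le> l" "2 ^ length (dss ! j) \<le> 2 * l + 1" "j < length dss"
    using assms by (simp_all add: represents_def)
  have "2 ^ length (inc (dss ! j)) \<le> 2 * Suc l + 1"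
    using length_inc[of "dss ! j"] j by auto
  then show ?thesis
    using represents_Suc[OF assms(1)] j by (auto simp: represents_def nth_list_update val_inc)
qed

lemma represents_dec:
  assumes "represents l dss c" "j < K" "0 < val (dss ! j)"
  shows "represents l (dss[j := dec (dss ! j)]) (c(j := c j - 1))"
  using assms by (auto simp: represents_def nth_list_update val_dec)

lemma represents_fits: "represents l dss c \<Longrightarrow> 2 * l + 1 < 2 ^ Suc B \<Longrightarrow> fits B (tapes dss)"
  by (rule fits_tapes[of _ "2 * l + 1"]) (auto simp: represents_def)

lemma tree_enter:
  assumes dss: "represents l dss c" and B: "2 * Suc l + 1 < 2 ^ Suc B"
    and q: "q \<in> Q" and u: "counter_of u \<subseteq> {..<K}"
    and tree: "\<And>dss' c'. represents (Suc l) dss' c' \<Longrightarrow>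
      comp_tree machine x B (conf (Main q) p (tapes dss')) (f c')"
  shows "comp_tree machine x B (conf (enter u q) p (tapes dss))
    (if enabled u c then f (apply_op u c) else 0)"
proof -
  have f: "fits B (tapes dss)"
    using B by (intro represents_fits[OF dss]) simp
  show ?thesis
  proof (cases u)
    case Keep
    then show ?thesis using tree[OF represents_Suc[OF dss]] by simp
  next
    case (Inc j)
    then have j: "j < K" using u by simp
    note inc = represents_inc[OF dss j]
    have "length (fst (tapes (dss[j := inc (dss ! j)]) ! j)) \<le> B"
      using represents_fits[OF inc B] j by (simp add: fits_def del: tapes_simps)
    then have "length (inc (dss ! j)) \<le> B"
      using j dss by (simp add: represents_def)
    with tree_Up[OF f j q, of 0 "dss ! j" x p] tree[OF inc] Inc show ?thesis
      by (simp add: tapes_update_id)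
  next
    case (Dec j)
    then have j: "j < K" using u by simp
    then have c: "val (dss ! j) = c j" and "length (dss ! j) \<le> B"
      using dss f by (simp_all add: represents_def fits_def)
    with tree_Down[OF f j q, of 0 "dss ! j" x p "f (c(j := c j - 1))"]
      tree[OF represents_Suc[OF represents_dec[OF dss j]]] Dec show ?thesis
      by (cases "0 < c j") (simp_all add: tapes_update_id)
  qed
qed

text \<open>
  The simulation: if \<open>y\<close> has been read and \<open>w\<close> remains, the accepting computations of the machine
  are counted by the accepting runs of the automaton on \<open>w\<close>. The input head is one cell to the right
  of \<open>y\<close>, hence at position \<open>length y + 1\<close>.
\<close>

lemma tree_Main:
  assumes "x = y @ w" "q \<in> Q" "represents (length y) dss c" "2 * length x + 1 < 2 ^ Suc B"
  shows "comp_tree machine x B (conf (Main q) (int (length y) + 1) (tapes dss)) (runs q c w)"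
  using assms
proof (induction w arbitrary: y q c dss)
  case Nil
  let ?p = "int (length y) + 1"
  have f: "fits B (tapes dss)"
    using Nil.prems by (intro represents_fits[of "length y" _ c]) auto
  have l: "length dss = K" and c: "\<And>j. j < K \<Longrightarrow> val (dss ! j) = c j"
    using Nil.prems by (simp_all add: represents_def)
  have s: "scan_input x ?p = Right_End"
    using Nil.prems by (simp add: scan_input_def)
  have ds: "length (dss ! 0) \<le> B"
    using f l K by (simp add: fits_def)
  have q: "Main q \<in> machine_states" using Nil.prems by (simp add: machine_states_intros)
  show ?case
  proof (cases "q \<in> F")
    case False
    then show ?thesis
      using tree_reject[OF f ds, of 0 "Main q" 0 x ?p] q s by (simp add: tapes_update_id)
  next
    case True
    have "(\<forall>i. 0 \<le> i \<and> i < K \<longrightarrow> val (fst (tapes dss ! i)) = 0) \<longleftrightarrow> (\<forall>j<K. c j = 0)"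
      using l c by simp
    moreover have "comp_tree machine x B (conf (Test 0) ?p (tapes dss))
        (of_bool (\<forall>i. 0 \<le> i \<and> i < K \<longrightarrow> val (fst (tapes dss ! i)) = 0))"
      by (rule tree_Test[OF f]) (use l in simp_all)
    ultimately have "comp_tree machine x B (conf (Test 0) ?p (tapes dss)) (runs q c [])"
      using True by simp
    then show ?thesis
      using tree_step[OF f ds, of 0 "Main q" 0 x ?p "Test 0" 0 "digits (dss ! 0) 0" 0 "dss ! 0"
          "runs q c []"] q s True
      by (simp add: tapes_update_id del: runs.simps)
  qed
next
  case (Cons a w)
  let ?p = "int (length y) + 1"
  let ?h = "\<lambda>(q', u). conf (enter u q') (?p + 1) (tapes dss)"
  have f: "fits B (tapes dss)"
    using Cons.prems by (intro represents_fits[of "length y" _ c]) auto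
  have l: "length (tapes dss) = K" "tapes dss ! active (Main q) = (dss ! 0, 0)"
    using Cons.prems K by (simp_all add: represents_def)
  have s: "scan_input x ?p = Letter a"
    using Cons.prems(1) by (simp add: scan_input_def)
  have id: "(map (\<lambda>(ds, h). (digits ds, h)) (tapes dss))[0 := (digits (dss ! 0), 0)] =
      map (\<lambda>(ds, h). (digits ds, h)) (tapes dss)"
    using map_update[of "\<lambda>(ds, h). (digits ds, h)" "tapes dss" 0 "(dss ! 0, 0)"]
    by (simp add: tapes_update_id)
  have q: "Main q \<in> machine_states" using Cons.prems by (simp add: machine_states_intros)
  show ?case
  proof (rule comp_tree_branch[where I = "\<delta> q a" and h = ?h
        and f = "\<lambda>(q', u). if enabled u c then runs q' (apply_op u c) w else 0"])
    show "step machine x (conf (Main q) ?p (tapes dss)) c' \<longleftrightarrow> c' \<in> ?h ` \<delta> q a" for c'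
      unfolding step_conf[OF q l] s by (force simp: conf_def id)
    show "inj_on ?h (\<delta> q a)"
      by (auto simp: inj_on_def conf_def enter_inject)
    show "comp_tree machine x B (?h i)
        (case i of (q', u) \<Rightarrow> if enabled u c then runs q' (apply_op u c) w else 0)"
      if "i \<in> \<delta> q a" for i
    proof -
      obtain q' u where i: "i = (q', u)" by force
      have q': "q' \<in> Q" "counter_of u \<subseteq> {..<K}"
        using \<delta>[OF Cons.prems(2), of q' u a] that i by auto
      have "comp_tree machine x B (conf (Main q') (?p + 1) (tapes dss')) (runs q' c' w)"
        if "represents (Suc (length y)) dss' c'" for dss' c'
        using Cons.IH[of "y @ [a]" q' dss' c'] Cons.prems q' that by (simp add: add.commute)
      from tree_enter[where f = "\<lambda>c. runs q' c w", OF Cons.prems(3) _ q' this] show ?thesis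
        using Cons.prems i by simp
    qed
  qed (use f fits_heads in \<open>auto simp: conf_def machine_def\<close>)
qed

theorem runs_in_sharpL: "runs q0 (\<lambda>_. 0) \<in> sharpL"
proof (rule sharpL_if_comp_tree[OF ntm_machine])
  define b where "b = (\<lambda>n::nat. nat \<lfloor>log 2 (2 * real n + 1)\<rfloor>)"
  show "comp_tree machine x (b (length x)) (init_config machine) (runs q0 (\<lambda>_. 0) x)" for x
  proof -
    let ?dss = "replicate K []"
    have "log 2 (2 * real (length x) + 1) < real (Suc (b (length x)))"
      unfolding b_def by linarith
    then have "2 * real (length x) + 1 < 2 powr real (Suc (b (length x)))"
      by (subst (asm) log_less_iff) auto
    then have "real (2 * length x + 1) < real (2 ^ Suc (b (length x)))"
      by (subst (asm) powr_realpow) auto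
    then have B: "2 * length x + 1 < 2 ^ Suc (b (length x))"
      by (simp only: of_nat_less_iff)
    have r: "represents (length ([] :: bool list)) ?dss (\<lambda>_. 0)"
      by (simp add: represents_def)
    have f: "fits (b (length x)) (tapes ?dss)"
      using B by (intro represents_fits[OF r]) simp
    have t: "tapes ?dss = replicate K ([], 0)"
      by (simp add: tapes_def)
    have id: "(tapes ?dss)[0 := ([], 0)] = tapes ?dss"
      using tapes_update_id[of ?dss 0] K by simp
    have "comp_tree machine x (b (length x))
        (conf (Main q0) (int (length ([] :: bool list)) + 1) (tapes ?dss)) (runs q0 (\<lambda>_. 0) x)"
      by (rule tree_Main[OF _ q0 r B]) simp
    \<comment> \<open>one initial step takes the input head from the left end marker to the first letter\<close>
    then show ?thesis
      using tree_step[OF f, of "[]" 0 "Main q0" 0 x 0 "Main q0" 1 0 0 "[]"] id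
        machine_states_intros(1)[OF q0]
      unfolding init_config_eq t[symmetric] by (simp add: scan_input_def digits_def fun_upd_idem)
  qed
  have "(\<lambda>n. real (b n)) \<in> O(\<lambda>n. log 2 (2 * real n + 1))"
    by (rule bigoI[where c = 1]) (auto simp: b_def)
  also have "(\<lambda>n::nat. log 2 (2 * real n + 1)) \<in> O(\<lambda>n. ln (real n))"
    by real_asymp
  finally have "(\<lambda>n. real (b n)) \<in> O(\<lambda>n. ln (real n))" .
  moreover have "(\<lambda>n::nat. 2 :: real) \<in> O(\<lambda>n. ln (real n))" by real_asymp
  ultimately have "(\<lambda>n. real (b n) + 2) \<in> O(\<lambda>n. ln (real n))"
    by (rule sum_in_bigo)
  then have "(\<lambda>n. real K * (real (b n) + 2)) \<in> O(\<lambda>n. ln (real n))"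
    using K by (subst landau_o.big.cmult_in_iff) simp_all
  moreover have "real (num_tapes machine * (b n + 2)) = real K * (real (b n) + 2)" for n
    by (simp add: machine_def algebra_simps)
  ultimately show "(\<lambda>n. real (num_tapes machine * (b n + 2))) \<in> O(\<lambda>n. ln (real n))"
    by (simp only:)
qed

end


section \<open>Contingency tables as lists of rows\<close>

text \<open>
  \<open>m\<close> is the number of columns. The two kinds of tables are treated together: the entries are
  arbitrary for \<open>s = 0\<close> and at most 1 for \<open>s = 1\<close>. When the units of a row are distributed to its
  columns from left to right, \<open>s\<close> is the distance that has to be kept between successive columns.
  There has to be a column because the automaton below expects a first block of \<open>\<beta>\<close>.
\<close>

locale table_rows =
  fixes m s :: nat
  assumes m: "0 < m" and s: "s \<le> 1"
begin

text \<open>Rows with sum \<open>a\<close> whose entries in the columns before \<open>j\<close> are 0; a row is 0 outside \<open>{..<m}\<close>.\<close>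

definition rows_from :: "nat \<Rightarrow> nat \<Rightarrow> (nat \<Rightarrow> nat) set" where
  "rows_from j a = {v. (\<forall>i. i < j \<or> m \<le> i \<longrightarrow> v i = 0) \<and> (0 < s \<longrightarrow> (\<forall>i. v i \<le> 1)) \<and> (\<Sum>i<m. v i) = a}"

lemma rows_from_le_1: "v \<in> rows_from j a \<Longrightarrow> 0 < s \<Longrightarrow> v i \<le> 1"
  by (simp add: rows_from_def)

lemma rows_from_0: "rows_from j 0 = {\<lambda>_. 0}"
proof
  show "rows_from j 0 \<subseteq> {\<lambda>_. 0}"
  proof
    fix v assume "v \<in> rows_from j 0"
    then have "v i = 0" for i
      by (cases "i < m") (auto simp: rows_from_def)
    then show "v \<in> {\<lambda>_. 0}" by auto
  qed
qed (auto simp: rows_from_def)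

lemma sum_upd_Suc: "i < m \<Longrightarrow> (\<Sum>k<m. (v(i := Suc (v i))) k) = Suc (\<Sum>k<m. v k)" for v :: "nat \<Rightarrow> nat"
  by (simp add: sum.remove[of "{..<m}" i])

text \<open>
  A row is built up by repeatedly adding a unit in the leftmost nonzero column \<open>i\<close>. Since
  \<open>i\<close> is determined by the row, the union is disjoint (as used in \<open>sum_rows_from_Suc\<close>).
\<close>

lemma rows_from_Suc:
  "rows_from j (Suc a) = (\<Union>i\<in>{j..<m}. (\<lambda>v. v(i := Suc (v i))) ` rows_from (i + s) a)"
proof (intro Set.set_eqI iffI)
  fix v assume v: "v \<in> rows_from j (Suc a)"
  then have "(\<Sum>i<m. v i) \<noteq> 0" by (simp add: rows_from_def)
  then have ex: "\<exists>i. v i \<noteq> 0" by auto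
  \<comment> \<open>the leftmost nonzero column\<close>
  define i where "i = (LEAST i. v i \<noteq> 0)"
  have i: "v i \<noteq> 0" unfolding i_def using ex by (rule LeastI_ex)
  have less: "v k = 0" if "k < i" for k using not_less_Least[of k "\<lambda>i. v i \<noteq> 0"] that by (auto simp: i_def)
  have im: "j \<le> i" "i < m" using i v by (auto simp: rows_from_def not_less[symmetric])
  let ?v = "v(i := v i - 1)"
  have eq: "v = ?v(i := Suc (?v i))" using i by auto
  have "(\<Sum>k<m. ?v k) = a"
  proof -
    have "(\<Sum>k<m. v k) = Suc (\<Sum>k<m. ?v k)"
      using sum_upd_Suc[OF im(2), of ?v] unfolding eq[symmetric] .
    then show ?thesis using v by (simp only: rows_from_def mem_Collect_eq) simp
  qed
  moreover have "?v k = 0" if "k < i + s \<or> m \<le> k" for k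
  proof -
    have "v i \<le> 1" if "0 < s" using v that by (simp add: rows_from_def)
    with v less[of k] \<open>k < i + s \<or> m \<le> k\<close> s show ?thesis
      by (cases "k = i") (auto simp: rows_from_def le_Suc_eq)
  qed
  moreover have "?v k \<le> 1" if "0 < s" for k
    using v that by (simp add: rows_from_def le_diff_conv le_SucI)
  ultimately have "?v \<in> rows_from (i + s) a" by (simp add: rows_from_def)
  then show "v \<in> (\<Union>i\<in>{j..<m}. (\<lambda>v. v(i := Suc (v i))) ` rows_from (i + s) a)"
    using im eq by fastforce
next
  fix v assume "v \<in> (\<Union>i\<in>{j..<m}. (\<lambda>v. v(i := Suc (v i))) ` rows_from (i + s) a)"
  then obtain i u where i: "j \<le> i" "i < m" and u: "u \<in> rows_from (i + s) a" and v: "v = u(i := Suc (u i))"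
    by auto
  have "(\<Sum>k<m. v k) = Suc a" using u sum_upd_Suc[OF i(2), of u] by (simp add: v rows_from_def)
  moreover have "v k = 0" if "k < j \<or> m \<le> k" for k
    using u i that by (auto simp: v rows_from_def)
  moreover have "v k \<le> 1" if "0 < s" for k
    using u that by (auto simp: v rows_from_def)
  ultimately show "v \<in> rows_from j (Suc a)" by (simp add: rows_from_def)
qed

lemma finite_rows_from: "finite (rows_from j a)"
  by (induction a arbitrary: j) (auto simp: rows_from_0 rows_from_Suc)

lemma sum_rows_from_Suc:
  "(\<Sum>v\<in>rows_from j (Suc a). f v) = (\<Sum>i\<in>{j..<m}. \<Sum>v\<in>rows_from (i + s) a. f (v(i := Suc (v i))))"
proof -
  let ?g = "\<lambda>i v. v(i := Suc (v i))"
  have disj: "?g i ` rows_from (i + s) a \<inter> ?g k ` rows_from (k + s) a = {}" if "i < k" for i k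
  proof (rule equals0I)
    fix y assume "y \<in> ?g i ` rows_from (i + s) a \<inter> ?g k ` rows_from (k + s) a"
    then obtain u v where "y = ?g i u" "y = ?g k v" and v: "v \<in> rows_from (k + s) a"
      by (elim IntE imageE)
    then have "?g i u i = ?g k v i" by (simp only:)
    then show False using v that by (simp add: rows_from_def)
  qed
  have inj: "inj_on (?g i) A" for i and A :: "(nat \<Rightarrow> nat) set"
  proof (rule inj_onI)
    fix u v assume eq: "?g i u = ?g i v"
    show "u = v"
    proof
      fix k show "u k = v k" using fun_cong[OF eq, of k] by (cases "k = i") auto
    qed
  qed
  have "(\<Sum>v\<in>rows_from j (Suc a). f v) = (\<Sum>i\<in>{j..<m}. \<Sum>v\<in>?g i ` rows_from (i + s) a. f v)"
    unfolding rows_from_Suc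
  proof (rule sum.UNION_disjoint)
    show "\<forall>i\<in>{j..<m}. \<forall>k\<in>{j..<m}. i \<noteq> k \<longrightarrow>
        ?g i ` rows_from (i + s) a \<inter> ?g k ` rows_from (k + s) a = {}"
    proof (intro ballI impI)
      fix i k :: nat assume "i \<noteq> k"
      then consider "i < k" | "k < i" by linarith
      then show "?g i ` rows_from (i + s) a \<inter> ?g k ` rows_from (k + s) a = {}"
      proof cases
        case 1
        then show ?thesis by (rule disj)
      next
        case 2
        then show ?thesis by (subst Int_commute) (rule disj)
      qed
    qed
  qed (simp_all add: finite_rows_from)
  then show ?thesis by (simp add: sum.reindex[OF inj])
qed

text \<open>
  The tables with row sums \<open>\<alpha>\<close>, as lists of rows, whose column sums complete \<open>c\<close> to \<open>\<beta>\<close>. Here \<open>c\<close>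
  stands for the column sums of rows that have been dealt with already.
\<close>

definition tables :: "nat list \<Rightarrow> (nat \<Rightarrow> nat) \<Rightarrow> nat list \<Rightarrow> (nat \<Rightarrow> nat) list set" where
  "tables \<alpha> c \<beta> = {vs. list_all2 (\<lambda>v a. v \<in> rows_from 0 a) vs \<alpha> \<and>
     (\<forall>j<m. c j + (\<Sum>v\<leftarrow>vs. v j) = \<beta> ! j)}"

lemma tables_Nil: "tables [] c \<beta> = (if \<forall>j<m. c j = \<beta> ! j then {[]} else {})"
  by (auto simp: tables_def)

lemma tables_Cons: "tables (a # \<alpha>) c \<beta> = (\<Union>v\<in>rows_from 0 a. (#) v ` tables \<alpha> (\<lambda>i. c i + v i) \<beta>)"
  by (fastforce simp: tables_def list_all2_Cons2 add.assoc image_iff)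

lemma finite_tables: "finite (tables \<alpha> c \<beta>)"
  by (induction \<alpha> arbitrary: c) (auto simp: tables_Nil tables_Cons finite_rows_from)

lemma card_tables_Cons:
  "card (tables (a # \<alpha>) c \<beta>) = (\<Sum>v\<in>rows_from 0 a. card (tables \<alpha> (\<lambda>i. c i + v i) \<beta>))"
  unfolding tables_Cons
  by (subst card_UN_disjoint) (auto simp: finite_rows_from finite_tables card_image)

lemma tables_cong: "(\<And>i. i < m \<Longrightarrow> c i = c' i) \<Longrightarrow> tables \<alpha> c \<beta> = tables \<alpha> c' \<beta>"
  by (auto simp: tables_def)

definition CTs :: "nat list \<Rightarrow> nat list \<Rightarrow> nat mat set" where
  "CTs = (if 0 < s then CT0 else CT)"

lemma card_tables:
  assumes "length \<beta> = m"
  shows "card (tables \<alpha> (\<lambda>_. 0) \<beta>) = card (CTs \<alpha> \<beta>)"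
proof -
  let ?n = "length \<alpha>"
  let ?f = "\<lambda>vs. mat ?n m (\<lambda>(i, j). (vs ! i) j)"
  let ?g = "\<lambda>A. map (\<lambda>i j. if j < m then A $$ (i, j) else 0) [0..<?n]"
  have "bij_betw ?f (tables \<alpha> (\<lambda>_. 0) \<beta>) (CTs \<alpha> \<beta>)"
  proof (rule bij_betw_byWitness[where f' = ?g])
    have rows: "length vs = ?n" "\<And>i. i < ?n \<Longrightarrow> vs ! i \<in> rows_from 0 (\<alpha> ! i)"
        "\<And>j. j < m \<Longrightarrow> (\<Sum>v\<leftarrow>vs. v j) = \<beta> ! j"
      if "vs \<in> tables \<alpha> (\<lambda>_. 0) \<beta>" for vs
      using that by (auto simp: tables_def list_all2_conv_all_nth)
    show "\<forall>vs\<in>tables \<alpha> (\<lambda>_. 0) \<beta>. ?g (?f vs) = vs"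
    proof
      fix vs assume vs: "vs \<in> tables \<alpha> (\<lambda>_. 0) \<beta>"
      show "?g (?f vs) = vs"
      proof (rule nth_equalityI)
        fix i assume "i < length (?g (?f vs))"
        then have i: "i < ?n" by simp
        show "?g (?f vs) ! i = vs ! i"
          using i rows(2)[OF vs i] by (auto simp: rows_from_def fun_eq_iff)
      qed (use rows[OF vs] in simp)
    qed
    show "\<forall>A\<in>CTs \<alpha> \<beta>. ?f (?g A) = A"
      using assms by (auto simp: CTs_def CT_def CT0_def split: if_splits intro!: eq_matI)
    show "?f ` tables \<alpha> (\<lambda>_. 0) \<beta> \<subseteq> CTs \<alpha> \<beta>"
    proof (rule image_subsetI)
      fix vs assume vs: "vs \<in> tables \<alpha> (\<lambda>_. 0) \<beta>"
      have "(\<Sum>i<?n. (vs ! i) j) = \<beta> ! j" if "j < m" for j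
        using rows(1,3)[OF vs] that by (simp add: sum_list_sum_nth atLeast0LessThan)
      moreover have "(\<Sum>j<m. (vs ! i) j) = \<alpha> ! i" if "i < ?n" for i
        using rows(2)[OF vs that] by (simp add: rows_from_def)
      ultimately have CT: "?f vs \<in> CT \<alpha> \<beta>"
        using assms by (simp add: CT_def)
      moreover have "elements_mat (?f vs) \<subseteq> {0, 1}" if "0 < s"
      proof
        fix e assume "e \<in> elements_mat (?f vs)"
        then obtain i j where "i < ?n" "e = (vs ! i) j" by (auto simp: elements_mat_def)
        with rows_from_le_1[OF rows(2)[OF vs] that] have "e \<le> 1" by simp
        then show "e \<in> {0, 1}" by auto
      qed
      ultimately show "?f vs \<in> CTs \<alpha> \<beta>"
        using s by (auto simp: CTs_def CT0_def)
    qed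
    show "?g ` CTs \<alpha> \<beta> \<subseteq> tables \<alpha> (\<lambda>_. 0) \<beta>"
    proof (rule image_subsetI)
      fix A assume A: "A \<in> CTs \<alpha> \<beta>"
      then have CT: "A \<in> CT \<alpha> \<beta>" by (auto simp: CTs_def CT0_def split: if_splits)
      have le: "A $$ (i, j) \<le> 1" if "0 < s" "i < ?n" "j < m" for i j
      proof -
        have "A $$ (i, j) \<in> elements_mat A"
          using CT that assms by (auto simp: CT_def)
        with A that show ?thesis by (auto simp: CTs_def CT0_def)
      qed
      have "?g A ! i \<in> rows_from 0 (\<alpha> ! i)" if "i < ?n" for i
        using CT le that assms by (auto simp: rows_from_def CT_def)
      moreover have "(\<Sum>v\<leftarrow>?g A. v j) = \<beta> ! j" if "j < m" for j
        using CT that assms by (simp add: CT_def o_def interv_sum_list_conv_sum_set_nat atLeast0LessThan)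
      ultimately show "?g A \<in> tables \<alpha> (\<lambda>_. 0) \<beta>"
        by (simp add: tables_def list_all2_conv_all_nth)
    qed
  qed
  then show ?thesis by (rule bij_betw_same_card)
qed

end


section \<open>An automaton counting contingency tables\<close>

text \<open>
  The automaton has a counter \<open>j < m\<close> for the sum of each column, and the counter \<open>m\<close> for the
  number of rows. It counts \<open>n\<close> in state \<open>Count\<close>, and passes through \<open>Gap\<close> between the two
  separating zeros. At each 1 of \<open>\<alpha>\<close>, it chooses a column and increments its counter; in \<open>Row j\<close>, the
  next column within the current row has to be at least \<open>j\<close>. The zero that ends a row decrements
  counter \<open>m\<close> and leads to \<open>Sep\<close>, where either a new row or the second separating zero follows.
  \<open>First\<close> differs from \<open>Sep\<close> only in that there has to be a row. While reading \<open>\<beta>\<close>, the automaton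
  decrements the counter of column \<open>j\<close> in the states \<open>Col j\<close>, where no 1 of \<open>\<beta>\<close> at \<open>j\<close> has been read
  yet, and \<open>InCol j\<close>. A run gets to the end with all counters 0 iff \<open>n\<close> and the column sums are right.
\<close>

datatype table_state = Count | Gap | First | Row nat | Sep | Col nat | InCol nat

instance table_state :: countable
  by countable_datatype

context table_rows
begin

definition choices :: "nat \<Rightarrow> (table_state \<times> counter_op) set" where
  "choices j = (\<lambda>i. (Row (i + s), Inc i)) ` {j..<m}"

fun table_trans :: "table_state \<Rightarrow> bool \<Rightarrow> (table_state \<times> counter_op) set" where
  "table_trans Count b = (if b then {(Count, Inc m)} else {(Gap, Keep)})"
| "table_trans Gap b = (if b then {} else {(First, Keep)})"
| "table_trans First b = (if b then choices 0 else {})"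
| "table_trans (Row j) b = (if b then choices j else {(Sep, Dec m)})"
| "table_trans Sep b = (if b then choices 0 else {(Col 0, Keep)})"
| "table_trans (Col j) b = (if b then {(InCol j, Dec j)} else {})"
| "table_trans (InCol j) b =
    (if b then {(InCol j, Dec j)} else if Suc j < m then {(Col (Suc j), Keep)} else {})"

definition table_states :: "table_state set" where
  "table_states = {Count, Gap, First, Sep} \<union> Row ` {..m} \<union> Col ` {..<m} \<union> InCol ` {..<m}"

definition final_states :: "table_state set" where
  "final_states = {InCol j | j. Suc j = m}"

lemma mem_final_states: "q \<in> final_states \<longleftrightarrow> (\<exists>j. q = InCol j \<and> Suc j = m)"
  by (auto simp: final_states_def)

sublocale counter_automaton "Suc m" table_states Count final_states table_trans
proof
  show "q' \<in> table_states \<and> counter_of u \<subseteq> {..<Suc m}"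
    if "q \<in> table_states" "(q', u) \<in> table_trans q a" for q q' u a
    using that m s by (cases q) (auto simp: table_states_def choices_def split: if_splits)
qed (auto simp: table_states_def)

lemma sum_choices: "(\<Sum>(q', u)\<in>choices j. if enabled u c then f q' (apply_op u c) else 0) =
    (\<Sum>i\<in>{j..<m}. f (Row (i + s)) (c(i := Suc (c i))))"
  unfolding choices_def by (subst sum.reindex) (auto simp: inj_on_def)

lemma runs_Row_True:
  "runs (Row j) c (True # w) = (\<Sum>i\<in>{j..<m}. runs (Row (i + s)) (c(i := Suc (c i))) w)"
  using sum_choices[of c "\<lambda>q c. runs q c w"] by simp

text \<open>The encoding of \<open>\<beta>\<close> from column \<open>j\<close> on that matches the counter values \<open>c\<close>.\<close>

definition col_word :: "nat \<Rightarrow> (nat \<Rightarrow> nat) \<Rightarrow> bool list" where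
  "col_word j c = unary_list (map c [j..<m])"

lemma col_word_rec:
  assumes "j < m"
  shows "col_word j c = replicate (c j) True @ (if Suc j < m then False # col_word (Suc j) c else [])"
  using assms by (simp add: col_word_def upt_conv_Cons)

lemma col_word_iff:
  assumes "j < m"
  shows "[] = col_word j c \<longleftrightarrow> c j = 0 \<and> Suc j = m"
    and "True # w = col_word j c \<longleftrightarrow> 0 < c j \<and> w = col_word j (c(j := c j - 1))"
    and "False # w = col_word j c \<longleftrightarrow> c j = 0 \<and> Suc j < m \<and> w = col_word (Suc j) c"
proof -
  have "col_word (Suc j) (c(j := a)) = col_word (Suc j) c" for a
    by (auto simp: col_word_def intro!: arg_cong[where f = unary_list])
  note rec = col_word_rec[OF assms] this
  show "[] = col_word j c \<longleftrightarrow> c j = 0 \<and> Suc j = m"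
    using assms by (auto simp: rec)
  show "True # w = col_word j c \<longleftrightarrow> 0 < c j \<and> w = col_word j (c(j := c j - 1))"
    by (cases "c j") (auto simp: rec)
  show "False # w = col_word j c \<longleftrightarrow> c j = 0 \<and> Suc j < m \<and> w = col_word (Suc j) c"
    by (cases "c j") (auto simp: rec)
qed

text \<open>This part of the automaton is deterministic: there is one accepting run or none.\<close>

lemma runs_Col_InCol:
  assumes "j < m"
  shows "runs (Col j) c w = of_bool (w = col_word j c \<and> (\<forall>i. j \<le> i \<and> i < m \<longrightarrow> 0 < c i) \<and>
      (\<forall>i<j. c i = 0) \<and> c m = 0)"
    and "runs (InCol j) c w = of_bool (w = col_word j c \<and> (\<forall>i. j < i \<and> i < m \<longrightarrow> 0 < c i) \<and>
      (\<forall>i<j. c i = 0) \<and> c m = 0)"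
  using assms
proof (induction w arbitrary: j c)
  case Nil
  {
    case 1
    then show ?case by (auto simp: col_word_iff mem_final_states)
  next
    case 2
    have "(InCol j \<in> final_states \<and> (\<forall>i<Suc m. c i = 0)) \<longleftrightarrow>
        ([] = col_word j c \<and> (\<forall>i. j < i \<and> i < m \<longrightarrow> 0 < c i) \<and> (\<forall>i<j. c i = 0) \<and> c m = 0)"
      unfolding col_word_iff(1)[OF 2] using 2 by (auto simp: less_Suc_eq mem_final_states)
    then show ?case by simp
  }
next
  case (Cons a w)
  have upd: "(\<forall>i. j < i \<and> i < m \<longrightarrow> 0 < (c(j := k)) i) \<longleftrightarrow> (\<forall>i. j < i \<and> i < m \<longrightarrow> 0 < c i)"
    "(\<forall>i<j. (c(j := k)) i = 0) \<longleftrightarrow> (\<forall>i<j. c i = 0)" for j k c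
    by auto
  {
    case 1
    have pos: "(\<forall>i. j \<le> i \<and> i < m \<longrightarrow> 0 < c i) \<longleftrightarrow> 0 < c j \<and> (\<forall>i. j < i \<and> i < m \<longrightarrow> 0 < c i)"
      using 1 by (auto simp: le_less)
    show ?case
    proof (cases a)
      case True
      let ?c = "c(j := c j - 1)"
      have "runs (InCol j) ?c w = of_bool (w = col_word j ?c \<and> (\<forall>i. j < i \<and> i < m \<longrightarrow> 0 < ?c i) \<and>
          (\<forall>i<j. ?c i = 0) \<and> ?c m = 0)"
        by (rule Cons.IH(2)[OF 1])
      then show ?thesis
        using 1 True unfolding upd by (auto simp: col_word_iff pos)
    next
      case False
      then show ?thesis using 1 by (auto simp: col_word_iff pos)
    qed
  next
    case 2
    show ?case
    proof (cases a)
      case True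
      let ?c = "c(j := c j - 1)"
      have "runs (InCol j) ?c w = of_bool (w = col_word j ?c \<and> (\<forall>i. j < i \<and> i < m \<longrightarrow> 0 < ?c i) \<and>
          (\<forall>i<j. ?c i = 0) \<and> ?c m = 0)"
        by (rule Cons.IH(2)[OF 2])
      then show ?thesis
        using 2 True unfolding upd by (auto simp: col_word_iff)
    next
      case False
      show ?thesis
      proof (cases "Suc j < m")
        case True
        have "(\<forall>i. Suc j \<le> i \<and> i < m \<longrightarrow> 0 < c i) \<longleftrightarrow> (\<forall>i. j < i \<and> i < m \<longrightarrow> 0 < c i)"
          "(\<forall>i<Suc j. c i = 0) \<longleftrightarrow> c j = 0 \<and> (\<forall>i<j. c i = 0)"
          by (auto simp: less_Suc_eq Suc_le_eq)
        then show ?thesis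
          using 2 Cons.IH(1)[OF True, of c] False True by (auto simp: col_word_iff)
      next
        case no: False
        then show ?thesis using False 2 by (simp add: col_word_iff)
      qed
    qed
  }
qed

text \<open>
  In contrast to \<^const>\<open>unary_list\<close>, each block is followed by a zero; so the first of the two zeros
  between \<open>\<alpha>\<close> and \<open>\<beta>\<close> belongs to the last row.
\<close>

definition row_word :: "nat list \<Rightarrow> bool list" where
  "row_word \<alpha> = concat (map (\<lambda>a. replicate a True @ [False]) \<alpha>)"

text \<open>
  The runs through a block of \<open>a\<close> ones correspond to the rows with sum \<open>a\<close>: each row arises from
  exactly one sequence of column choices.
\<close>

lemma runs_Row:
  assumes "c m = Suc l"
  shows "runs (Row j) c (replicate a True @ False # w) =
    (\<Sum>v\<in>rows_from j a. runs Sep (\<lambda>i. (c(m := l)) i + v i) w)"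
  using assms
proof (induction a arbitrary: j c)
  case 0
  then show ?case by (simp add: rows_from_0 fun_upd_def)
next
  case (Suc a)
  have "runs (Row j) c (replicate (Suc a) True @ False # w) =
      (\<Sum>i\<in>{j..<m}. runs (Row (i + s)) (c(i := Suc (c i))) (replicate a True @ False # w))"
    by (simp only: replicate_Suc append_Cons runs_Row_True)
  also have "\<dots> = (\<Sum>i\<in>{j..<m}. \<Sum>v\<in>rows_from (i + s) a.
      runs Sep (\<lambda>k. (c(m := l)) k + (v(i := Suc (v i))) k) w)"
  proof (rule sum.cong[OF refl])
    fix i assume i: "i \<in> {j..<m}"
    have "((c(i := Suc (c i)))(m := l)) k + v k = (c(m := l)) k + (v(i := Suc (v i))) k" for k v
      using i by auto
    moreover have "runs (Row (i + s)) (c(i := Suc (c i))) (replicate a True @ False # w) =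
        (\<Sum>v\<in>rows_from (i + s) a. runs Sep (\<lambda>k. ((c(i := Suc (c i)))(m := l)) k + v k) w)"
      by (rule Suc.IH) (use Suc.prems i in simp)
    ultimately show "runs (Row (i + s)) (c(i := Suc (c i))) (replicate a True @ False # w) =
        (\<Sum>v\<in>rows_from (i + s) a. runs Sep (\<lambda>k. (c(m := l)) k + (v(i := Suc (v i))) k) w)"
      by (simp only:)
  qed
  finally show ?case by (simp only: sum_rows_from_Suc)
qed

lemma runs_Sep:
  assumes "\<forall>a\<in>set \<alpha>. 0 < a" "\<forall>b\<in>set \<beta>. 0 < b" "length \<beta> = m" "c m = length \<alpha>"
  shows "runs Sep c (row_word \<alpha> @ False # unary_list \<beta>) = card (tables \<alpha> c \<beta>)"
  using assms(1,4)
proof (induction \<alpha> arbitrary: c)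
  case Nil
  have inj: "unary_list \<beta> = unary_list \<beta>' \<longleftrightarrow> \<beta> = \<beta>'" if "length \<beta>' = m" for \<beta>'
    using unary_list_append_inj[of \<beta> \<beta>' "[]" "[]"] that assms(3) by auto
  have eq: "\<beta> = map c [0..<m] \<longleftrightarrow> (\<forall>j<m. c j = \<beta> ! j)"
    using assms(3) by (auto simp: list_eq_iff_nth_eq)
  have "unary_list \<beta> = col_word 0 c \<and> (\<forall>i. 0 \<le> i \<and> i < m \<longrightarrow> 0 < c i) \<longleftrightarrow> (\<forall>j<m. c j = \<beta> ! j)"
    using assms(2,3) by (auto simp: col_word_def inj eq)
  then have "runs (Col 0) c (unary_list \<beta>) = of_bool (\<forall>j<m. c j = \<beta> ! j)"
    using Nil.prems by (subst runs_Col_InCol(1)[OF m]) auto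
  then show ?case by (simp add: row_word_def tables_Nil)
next
  case (Cons a \<alpha>)
  obtain a' where a: "a = Suc a'" using Cons.prems(1) by (cases a) auto
  have "runs Sep c (row_word (a # \<alpha>) @ False # unary_list \<beta>) =
      runs (Row 0) c (replicate a True @ False # (row_word \<alpha> @ False # unary_list \<beta>))"
    by (simp add: row_word_def a)
  also have "\<dots> = (\<Sum>v\<in>rows_from 0 a. runs Sep (\<lambda>i. (c(m := length \<alpha>)) i + v i)
      (row_word \<alpha> @ False # unary_list \<beta>))"
    by (rule runs_Row) (use Cons.prems in simp)
  also have "\<dots> = (\<Sum>v\<in>rows_from 0 a. card (tables \<alpha> (\<lambda>i. c i + v i) \<beta>))"
  proof (rule sum.cong[OF refl])
    fix v assume v: "v \<in> rows_from 0 a"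
    have "runs Sep (\<lambda>i. (c(m := length \<alpha>)) i + v i) (row_word \<alpha> @ False # unary_list \<beta>) =
        card (tables \<alpha> (\<lambda>i. (c(m := length \<alpha>)) i + v i) \<beta>)"
      by (rule Cons.IH) (use v Cons.prems in \<open>auto simp: rows_from_def\<close>)
    also have "tables \<alpha> (\<lambda>i. (c(m := length \<alpha>)) i + v i) \<beta> = tables \<alpha> (\<lambda>i. c i + v i) \<beta>"
      by (rule tables_cong) simp
    finally show "runs Sep (\<lambda>i. (c(m := length \<alpha>)) i + v i) (row_word \<alpha> @ False # unary_list \<beta>) =
        card (tables \<alpha> (\<lambda>i. c i + v i) \<beta>)" .
  qed
  finally show ?case by (simp only: card_tables_Cons)
qed

lemma runs_Count:
  "runs Count c (replicate n True @ False # w) = runs Gap (c(m := c m + n)) w"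
  by (induction n arbitrary: c) (simp_all add: fun_upd_def cong: if_cong)

lemma encode_eq:
  assumes "\<alpha> \<noteq> []"
  shows "encode_marginals (\<alpha>, \<beta>) =
    replicate (length \<alpha>) True @ False # False # row_word \<alpha> @ False # unary_list \<beta>"
proof -
  have "unary_list \<alpha> @ [False] = row_word \<alpha>"
    using assms by (induction \<alpha> rule: unary_list.induct) (auto simp: row_word_def)
  from this[symmetric] show ?thesis by (simp add: encode_marginals_def)
qed

lemma runs_encode:
  assumes "(\<alpha>, \<beta>) \<in> marginals m"
  shows "runs Count (\<lambda>_. 0) (encode_marginals (\<alpha>, \<beta>)) = card (CTs \<alpha> \<beta>)"
proof -
  from assms have pos: "\<forall>a\<in>set \<alpha>. 0 < a" "\<forall>b\<in>set \<beta>. 0 < b" and len: "length \<beta> = m"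
    and sum: "sum_list \<alpha> = sum_list \<beta>"
    by (auto simp: marginals_def composition_def)
  have "\<alpha> \<noteq> []"
  proof
    assume "\<alpha> = []"
    then have "\<forall>b\<in>set \<beta>. b = 0" using sum by simp
    with pos len m show False by (cases \<beta>) auto
  qed
  then obtain a \<alpha>' where a: "\<alpha> = Suc a # \<alpha>'"
    using pos(1) by (cases \<alpha>) (auto simp: gr0_conv_Suc)
  let ?c = "(\<lambda>_. 0)(m := length \<alpha>)"
  have "runs Count (\<lambda>_. 0) (encode_marginals (\<alpha>, \<beta>)) = runs First ?c (row_word \<alpha> @ False # unary_list \<beta>)"
    unfolding encode_eq[OF \<open>\<alpha> \<noteq> []\<close>] runs_Count by simp
  also have "\<dots> = runs Sep ?c (row_word \<alpha> @ False # unary_list \<beta>)"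
    by (simp add: a row_word_def)
  also have "\<dots> = card (tables \<alpha> ?c \<beta>)"
    by (rule runs_Sep) (use pos len in simp_all)
  also have "tables \<alpha> ?c \<beta> = tables \<alpha> (\<lambda>_. 0) \<beta>"
    by (rule tables_cong) simp
  finally show ?thesis by (simp add: card_tables[OF len])
qed

text \<open>
  Conversely, a word with an accepting run is the remainder of an encoding. The conditions on the
  counters ensure that the number of rows and the total sums are correct as well.
\<close>

lemma word_if_runs:
  "runs Sep c w \<noteq> 0 \<Longrightarrow> \<exists>\<alpha> \<beta>. w = row_word \<alpha> @ False # unary_list \<beta> \<and> (\<forall>a\<in>set \<alpha>. 0 < a) \<and>
     (\<forall>b\<in>set \<beta>. 0 < b) \<and> length \<beta> = m \<and> c m = length \<alpha> \<and> (\<Sum>i<m. c i) + sum_list \<alpha> = sum_list \<beta>"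
  "runs (Row j) c w \<noteq> 0 \<Longrightarrow> \<exists>a \<alpha> \<beta>. w = replicate a True @ False # row_word \<alpha> @ False # unary_list \<beta> \<and>
     (\<forall>a\<in>set \<alpha>. 0 < a) \<and> (\<forall>b\<in>set \<beta>. 0 < b) \<and> length \<beta> = m \<and> c m = Suc (length \<alpha>) \<and>
     (\<Sum>i<m. c i) + a + sum_list \<alpha> = sum_list \<beta>"
proof (induction w arbitrary: c j)
  case Nil
  {
    case 1
    then show ?case by (simp add: mem_final_states)
  next
    case 2
    then show ?case by (simp add: mem_final_states)
  }
next
  case (Cons b w)
  have row: "\<exists>a \<alpha> \<beta>. b # w = replicate (Suc a) True @ False # row_word \<alpha> @ False # unary_list \<beta> \<and>
     (\<forall>a\<in>set \<alpha>. 0 < a) \<and> (\<forall>b\<in>set \<beta>. 0 < b) \<and> length \<beta> = m \<and> c m = Suc (length \<alpha>) \<and>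
     (\<Sum>i<m. c i) + Suc a + sum_list \<alpha> = sum_list \<beta>"
    if "b" "runs (Row j) c (b # w) \<noteq> 0" for j c
  proof -
    from that obtain i where i: "i < m" "runs (Row (i + s)) (c(i := Suc (c i))) w \<noteq> 0"
      using runs_Row_True[of j c w] by (auto simp del: runs.simps dest: sum.not_neutral_contains_not_neutral)
    from Cons.IH(2)[OF i(2)] obtain a \<alpha> \<beta> where
      "w = replicate a True @ False # row_word \<alpha> @ False # unary_list \<beta>"
      "\<forall>a\<in>set \<alpha>. 0 < a" "\<forall>b\<in>set \<beta>. 0 < b" "length \<beta> = m" "(c(i := Suc (c i))) m = Suc (length \<alpha>)"
      "(\<Sum>k<m. (c(i := Suc (c i))) k) + a + sum_list \<alpha> = sum_list \<beta>"
      by blast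
    then show ?thesis
      using i(1) \<open>b\<close> unfolding sum_upd_Suc[OF i(1)]
      by (intro exI[of _ a] exI[of _ \<alpha>] exI[of _ \<beta>]) auto
  qed
  {
    case 1
    show ?case
    proof (cases b)
      case True
      with 1 have "runs (Row 0) c (b # w) \<noteq> 0" by simp
      from row[OF True this] obtain a \<alpha> \<beta> where
        "b # w = replicate (Suc a) True @ False # row_word \<alpha> @ False # unary_list \<beta>"
        "\<forall>a\<in>set \<alpha>. 0 < a" "\<forall>b\<in>set \<beta>. 0 < b" "length \<beta> = m" "c m = Suc (length \<alpha>)"
        "(\<Sum>i<m. c i) + Suc a + sum_list \<alpha> = sum_list \<beta>"
        by blast
      then show ?thesis
        by (intro exI[of _ "Suc a # \<alpha>"] exI[of _ \<beta>]) (auto simp: row_word_def)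
    next
      case False
      with 1 have "runs (Col 0) c w \<noteq> 0" by simp
      then have "w = unary_list (map c [0..<m])" "\<forall>i<m. 0 < c i" "c m = 0"
        unfolding runs_Col_InCol(1)[OF m] by (auto simp: col_word_def)
      then show ?thesis using False
        by (intro exI[of _ "[]"] exI[of _ "map c [0..<m]"])
           (auto simp: row_word_def interv_sum_list_conv_sum_set_nat atLeast0LessThan)
    qed
  next
    case 2
    show ?case
    proof (cases b)
      case True
      then show ?thesis using row[OF True 2] by blast
    next
      case False
      with 2 have c: "0 < c m" "runs Sep (c(m := c m - 1)) w \<noteq> 0" by (auto split: if_splits)
      from Cons.IH(1)[OF c(2)] obtain \<alpha> \<beta> where
        "w = row_word \<alpha> @ False # unary_list \<beta>" "\<forall>a\<in>set \<alpha>. 0 < a" "\<forall>b\<in>set \<beta>. 0 < b"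
        "length \<beta> = m" "(c(m := c m - 1)) m = length \<alpha>"
        "(\<Sum>i<m. (c(m := c m - 1)) i) + sum_list \<alpha> = sum_list \<beta>"
        by blast
      then show ?thesis using False c(1)
        by (intro exI[of _ 0] exI[of _ \<alpha>] exI[of _ \<beta>]) auto
    qed
  }
qed

lemma word_if_runs_Count:
  assumes "runs Count c x \<noteq> 0"
  shows "\<exists>n w. x = replicate n True @ False # False # True # w \<and> runs Sep (c(m := c m + n)) (True # w) \<noteq> 0"
  using assms
proof (induction x arbitrary: c)
  case Nil
  then show ?case by (simp add: mem_final_states)
next
  case (Cons b x)
  show ?case
  proof (cases b)
    case True
    then have "runs Count (c(m := Suc (c m))) x \<noteq> 0" using Cons.prems by simp
    from Cons.IH[OF this] obtain n w where x: "x = replicate n True @ False # False # True # w"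
      and w: "runs Sep ((c(m := Suc (c m)))(m := (c(m := Suc (c m))) m + n)) (True # w) \<noteq> 0"
      by blast
    have "(c(m := Suc (c m)))(m := (c(m := Suc (c m))) m + n) = c(m := c m + Suc n)"
      by auto
    from w[unfolded this] have "runs Sep (c(m := c m + Suc n)) (True # w) \<noteq> 0" .
    moreover have "b # x = replicate (Suc n) True @ False # False # True # w"
      using x True by simp
    ultimately show ?thesis by blast
  next
    case False
    then have gap: "runs Gap c x \<noteq> 0" using Cons.prems by simp
    then obtain x' where x: "x = False # x'" by (cases x) (auto simp: mem_final_states split: if_splits)
    with gap have first: "runs First c x' \<noteq> 0" by simp
    then obtain w where w: "x' = True # w" by (cases x') (auto simp: mem_final_states split: if_splits)
    with first have "runs Sep c (True # w) \<noteq> 0" by simp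
    with x w False show ?thesis
      by (intro exI[of _ 0] exI[of _ w]) (simp del: runs.simps)
  qed
qed

lemma runs_eq_zero_ext:
  "runs Count (\<lambda>_. 0) = zero_ext encode_marginals (marginals m) (\<lambda>(\<alpha>, \<beta>). card (CTs \<alpha> \<beta>))"
proof
  fix x
  show "runs Count (\<lambda>_. 0) x = zero_ext encode_marginals (marginals m) (\<lambda>(\<alpha>, \<beta>). card (CTs \<alpha> \<beta>)) x"
  proof (cases "x \<in> encode_marginals ` marginals m")
    case True
    then obtain \<alpha> \<beta> where x: "x = encode_marginals (\<alpha>, \<beta>)" "(\<alpha>, \<beta>) \<in> marginals m" by auto
    then show ?thesis by (simp add: zero_ext_encode_marginals runs_encode)
  next
    case False
    have "runs Count (\<lambda>_. 0) x = 0"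
    proof (rule ccontr)
      assume "runs Count (\<lambda>_. 0) x \<noteq> 0"
      from word_if_runs_Count[OF this] obtain n w where
        x: "x = replicate n True @ False # False # True # w" and
        w: "runs Sep ((\<lambda>_. 0)(m := n)) (True # w) \<noteq> 0"
        by (auto simp del: runs.simps)
      from word_if_runs(1)[OF w] obtain \<alpha> \<beta> where
        ab: "True # w = row_word \<alpha> @ False # unary_list \<beta>" "\<forall>a\<in>set \<alpha>. 0 < a" "\<forall>b\<in>set \<beta>. 0 < b"
        "length \<beta> = m" "n = length \<alpha>" "sum_list \<alpha> = sum_list \<beta>"
        by auto
      then have "\<alpha> \<noteq> []" by (auto simp: row_word_def)
      then have "x = encode_marginals (\<alpha>, \<beta>)" using x ab by (simp add: encode_eq)
      moreover have "(\<alpha>, \<beta>) \<in> marginals m"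
        using ab by (simp add: marginals_def composition_def)
      ultimately show False using False by blast
    qed
    then show ?thesis using False by (simp add: zero_ext_def)
  qed
qed

lemma card_CTs_in_sharpL:
  "zero_ext encode_marginals (marginals m) (\<lambda>(\<alpha>, \<beta>). card (CTs \<alpha> \<beta>)) \<in> sharpL"
  using runs_in_sharpL by (simp add: runs_eq_zero_ext)

end


section \<open>Tables without columns\<close>

text \<open>
  For \<open>m = 0\<close> the only pair of marginals consists of two empty lists, and its encoding is \<open>0000\<close>.
  The automaton for this word counts the zeros in its states and does not use its counter.
\<close>

fun zeros_trans :: "nat \<Rightarrow> bool \<Rightarrow> (nat \<times> counter_op) set" where
  "zeros_trans q True = {}"
| "zeros_trans q False = (if q < 4 then {(Suc q, Keep)} else {})"

interpretation zeros: counter_automaton "Suc 0" "{..4}" 0 "{4}" zeros_trans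
proof
  show "q' \<in> {..4} \<and> counter_of u \<subseteq> {..<Suc 0}" if "(q', u) \<in> zeros_trans q b" for q q' u b
    using that by (cases b) (auto split: if_splits)
qed auto

lemma zeros_runs: "q \<le> 4 \<Longrightarrow> c 0 = 0 \<Longrightarrow> zeros.runs q c w = of_bool (w = replicate (4 - q) False)"
proof (induction w arbitrary: q)
  case (Cons b w)
  have "4 - q = Suc (4 - Suc q)" if "q < 4" using that by simp
  then show ?case using Cons by (cases b; cases "q < 4") auto
qed auto

lemma zero_ext_no_columns:
  assumes "g ([], []) = 1"
  shows "zero_ext encode_marginals (marginals 0) g \<in> sharpL"
proof -
  have "marginals 0 = {([], [])}"
    by (auto simp: marginals_def composition_def)
       (metis all_not_in_conv gr_implies_not0 set_empty)
  moreover have e: "encode_marginals ([], []) = replicate 4 False"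
    by (simp add: encode_marginals_def numeral_eq_Suc)
  ultimately have mem: "x \<in> encode_marginals ` marginals 0 \<longleftrightarrow> x = replicate 4 False" for x
    by simp
  have "zero_ext encode_marginals (marginals 0) g x = zeros.runs 0 (\<lambda>_. 0) x" for x
  proof (cases "x = replicate 4 False")
    case True
    have "zero_ext encode_marginals (marginals 0) g x = 1"
      unfolding True e[symmetric]
      by (subst zero_ext_encode_marginals) (simp_all add: marginals_def composition_def assms)
    then show ?thesis using True by (simp add: zeros_runs)
  next
    case False
    then show ?thesis by (simp add: zero_ext_def mem zeros_runs)
  qed
  then have "zero_ext encode_marginals (marginals 0) g = zeros.runs 0 (\<lambda>_. 0)" by (rule ext)
  then show ?thesis using zeros.runs_in_sharpL by simp
qed

lemma card_CT_Nil: "card (CT [] []) = 1" "card (CT0 [] []) = 1"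
proof -
  have "CT [] [] = {mat 0 0 (\<lambda>_. 0)}"
    by (auto simp: CT_def)
  moreover from this have "CT0 [] [] = {mat 0 0 (\<lambda>_. 0)}"
    by (auto simp: CT0_def elements_mat_def)
  ultimately show "card (CT [] []) = 1" "card (CT0 [] []) = 1" by simp_all
qed


section \<open>Counting contingency tables in logarithmic space\<close>

theorem theorem4p5:
  fixes m :: nat
  shows "zero_ext encode_marginals (marginals m) (\<lambda>(\<alpha>, \<beta>). card (CT \<alpha> \<beta>)) \<in> sharpL \<and>
         zero_ext encode_marginals (marginals m) (\<lambda>(\<alpha>, \<beta>). card (CT0 \<alpha> \<beta>)) \<in> sharpL"
proof (cases "m = 0")
  case True
  then show ?thesis by (simp add: zero_ext_no_columns card_CT_Nil)
next
  case False
  interpret all: table_rows m 0 by unfold_locales (use False in auto)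
  interpret binary: table_rows m "Suc 0" by unfold_locales (use False in auto)
  show ?thesis
    using all.card_CTs_in_sharpL binary.card_CTs_in_sharpL
    by (simp add: all.CTs_def binary.CTs_def)
qed

end
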